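(* The standard embedding $F\to \mathrm{Homeo}([0,1])$ extends to an embedding (injective group homomorphism) $\bar F\to \mathrm{Homeo}([0,1])$.
   Context: $F$ (R. Thompson's group) is the group of all piecewise-linear increasing self-homeomorphisms of $[0,1]$ with finitely many break points of the derivative, all lying in $\mathbb{Z}[\frac12]$, and with all slopes powers of $2$; the standard embedding is the inclusion into $\mathrm{Homeo}([0,1])$. Let $\mu$ be Lebesgue measure on $[0,1]$. The Hamming metric on $F$ is $$\mathrm{dist}_H(f,g)=\mu(\{x\mid f(x)\ne g(x)\}) + \mu(\{x\mid f^{-1}(x)\ne g^{-1}(x)\}).$$ The group operations of $F$ are continuous with respect to $\mathrm{dist}_H$. $\bar F$ denotes the (Raĭkov) completion of $F$ with respect to $\mathrm{dist}_H$: its elements are $\mathrm{dist}_H$-Cauchy sequences $(f_n)_{n\ge1}$ of elements of $F$, two sequences $(f_n),(g_n)$ being equivalent (equal in $\bar F$) if $\lim_{n\to\infty}\mathrm{dist}_H(f_n,g_n)=0$, with termwise multiplication; $F$ embeds in $\bar F$ via constant sequences. *)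

theory Defs
  imports "HOL-Analysis.Analysis" "HOL-Algebra.Bij"
begin

text \<open>
  A self-map of the unit interval is an extensional function on \<open>{0..1}\<close> (as in
  \<^const>\<open>BijGroup\<close>, whose composition and identity are reused here), so that equality
  of group elements is equality of maps on \<open>[0,1]\<close>.
\<close>

definition Homeo01 :: "(real \<Rightarrow> real) monoid" where
  "Homeo01 = (BijGroup {0..1})
     \<lparr>carrier := {f \<in> extensional {0..1}. \<exists>g. homeomorphism {0..1} {0..1} f g}\<rparr>"

definition dyadic :: "real set" where
  "dyadic = {x. \<exists>(a::int) (n::nat). x = of_int a / 2 ^ n}"

definition piecewise_linear :: "(real \<Rightarrow> real) \<Rightarrow> bool" where
  "piecewise_linear f \<longleftrightarrow> (\<exists>B. finite B \<and>
     (\<forall>a b. 0 \<le> a \<and> a < b \<and> b \<le> 1 \<and> {a<..<b} \<inter> B = {} \<longrightarrow>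
        (\<exists>m c. \<forall>x\<in>{a..b}. f x = m * x + c)))"

text \<open>
  For a continuous piecewise-linear map, the points of discontinuity of the derivative are
  exactly the interior points where the map is not differentiable.
\<close>

definition break_points :: "(real \<Rightarrow> real) \<Rightarrow> real set" where
  "break_points f = {x \<in> {0<..<1}. \<not> f differentiable (at x)}"

definition Thompson_F :: "(real \<Rightarrow> real) monoid" where
  "Thompson_F = Homeo01
     \<lparr>carrier := {f \<in> carrier Homeo01. strict_mono_on {0..1} f \<and> piecewise_linear f \<and>
        finite (break_points f) \<and> break_points f \<subseteq> dyadic \<and>
        (\<forall>x \<in> {0<..<1} - break_points f. \<exists>k::int. (f has_real_derivative 2 powi k) (at x))}\<rparr>"

definition dist_H :: "(real \<Rightarrow> real) \<Rightarrow> (real \<Rightarrow> real) \<Rightarrow> real" where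
  "dist_H f g = measure lebesgue {x \<in> {0..1}. f x \<noteq> g x}
     + measure lebesgue {x \<in> {0..1}. inv_into {0..1} f x \<noteq> inv_into {0..1} g x}"

definition Cauchy_F :: "(nat \<Rightarrow> real \<Rightarrow> real) set" where
  "Cauchy_F = {f. (\<forall>n. f n \<in> carrier Thompson_F) \<and>
     (\<forall>e>0. \<exists>N. \<forall>m\<ge>N. \<forall>n\<ge>N. dist_H (f m) (f n) < e)}"

definition equiv_H :: "((nat \<Rightarrow> real \<Rightarrow> real) \<times> (nat \<Rightarrow> real \<Rightarrow> real)) set" where
  "equiv_H = {(f, g). f \<in> Cauchy_F \<and> g \<in> Cauchy_F \<and> (\<lambda>n. dist_H (f n) (g n)) \<longlonglongrightarrow> 0}"

definition const_class :: "(real \<Rightarrow> real) \<Rightarrow> (nat \<Rightarrow> real \<Rightarrow> real) set" where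
  "const_class f = equiv_H `` {\<lambda>n. f}"

text \<open>
  The product of two classes is the union of the classes of the termwise products of all pairs
  of representatives; since the termwise product respects \<open>equiv_H\<close>, this union is a single
  class.
\<close>

definition F_bar :: "(nat \<Rightarrow> real \<Rightarrow> real) set monoid" where
  "F_bar = \<lparr>carrier = Cauchy_F // equiv_H,
     monoid.mult = (\<lambda>A B. \<Union>f\<in>A. \<Union>g\<in>B. equiv_H `` {\<lambda>n. f n \<otimes>\<^bsub>Thompson_F\<^esub> g n}),
     one = const_class \<one>\<^bsub>Thompson_F\<^esub>\<rparr>"

end

theory Submission
  imports Defs
begin

text \<open>
  The embedding sends the class of a Cauchy sequence to the pointwise limit of the sequence. It
  exists because the Hamming metric dominates the uniform metric: if \<open>f x < g x\<close>, then the inverses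
  of \<open>f\<close> and \<open>g\<close> disagree on the whole interval between \<open>f x\<close> and \<open>g x\<close>
  (\<open>abs_diff_le_disagree_inv\<close>). So a Cauchy sequence and the sequence of its inverses both converge
  uniformly, the limits are continuous and inverse to each other (\<open>lim_F_inv\<close>), and equivalent
  sequences have the same limit (\<open>lim_F_cong\<close>). Uniform convergence also makes the limit
  multiplicative (\<open>lim_F_mult\<close>).

  Injectivity uses that a Cauchy sequence converges to its limit in measure and not merely uniformly.
  If \<open>f n x\<close> differs from the limit at \<open>x\<close>, then it differs from \<open>f m x\<close> for all large \<open>m\<close>, so a
  Fatou argument bounds the measure of such \<open>x\<close> by the Cauchy condition (\<open>disagree_lim_le\<close>). Two
  sequences with the same limit, whose inverses then have the same limit as well, are therefore
  equivalent (\<open>lim_F_eq_imp_equiv_H\<close>).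

  It remains to see that the completion is a group at all. Two facts are needed. Thompson's group is
  closed under composition and inversion; the only delicate point is that break points remain dyadic,
  which holds because its elements permute the dyadic points (\<open>dyadic_affine_off_dyadic_iff\<close>). And
  the termwise product of Cauchy sequences must be Cauchy and respect equivalence. The metric is not
  invariant under translation: passing from \<open>p\<close>, \<open>p'\<close> to \<open>p \<circ> q\<close>, \<open>p' \<circ> q\<close> replaces the disagreement
  set by its \<open>q\<close>-preimage, and the slopes of \<open>q\<close> have no common lower bound. Along a Cauchy sequence
  this does no harm: each term agrees, off a set of small measure, with one fixed term of the
  sequence, and that one changes measure by a bounded factor only (\<open>expansion_measure_image\<close>,
  \<open>disagree_mult\<close>).
\<close>

section \<open>The group of homeomorphisms of the unit interval\<close>

lemma continuous_on_restrict_self [simp]: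
  "continuous_on S (restrict f S) \<longleftrightarrow> continuous_on S f"
  by (rule continuous_on_cong) auto

text \<open>
  A continuous bijection of the compact interval is automatically a homeomorphism, so continuity
  of the inverse never has to be checked separately.
\<close>

lemma carrier_Homeo01:
  "carrier Homeo01 = {f \<in> Bij {0..1}. continuous_on {0..1} f}"
proof -
  have "(\<exists>g. homeomorphism {0..1} {0..1} f g) \<longleftrightarrow>
        bij_betw f {0..1} {0..1} \<and> continuous_on {0..1} f" for f :: "real \<Rightarrow> real"
  proof
    assume "\<exists>g. homeomorphism {0..1} {0..1} f g"
    then obtain g where g: "homeomorphism {0..1} {0..1} f g" ..
    then have "inj_on f {0..1}"
      by (metis homeomorphism_def inj_on_inverseI)
    with g show "bij_betw f {0..1} {0..1} \<and> continuous_on {0..1} f"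
      by (simp add: homeomorphism_def bij_betw_def)
  next
    assume "bij_betw f {0..1} {0..1} \<and> continuous_on {0..1} f"
    then show "\<exists>g. homeomorphism {0..1} {0..1} f g"
      by (intro homeomorphism_compact) (auto simp: bij_betw_def)
  qed
  then show ?thesis
    by (auto simp: Homeo01_def Bij_def)
qed

lemma Homeo01_eq: "Homeo01 = BijGroup {0..1} \<lparr>carrier := carrier Homeo01\<rparr>"
  by (simp add: Homeo01_def)

lemma Homeo01_bij_betw: "f \<in> carrier Homeo01 \<Longrightarrow> bij_betw f {0..1} {0..1}"
  by (simp add: carrier_Homeo01 Bij_def)

lemma Homeo01_mem:
  assumes "f \<in> carrier Homeo01" "x \<in> {0..1}"
  shows "f x \<in> {0..1}" "inv_into {0..1} f x \<in> {0..1}"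
    "f (inv_into {0..1} f x) = x" "inv_into {0..1} f (f x) = x"
  using assms bij_betw_inv_into[OF Homeo01_bij_betw[OF assms(1)]] Homeo01_bij_betw[OF assms(1)]
  by (auto simp: bij_betw_inv_into_left bij_betw_inv_into_right dest: bij_betwE)

lemma Homeo01_continuous_inv_into:
  assumes f: "f \<in> carrier Homeo01"
  shows "continuous_on {0..1} (inv_into {0..1} f)"
proof -
  obtain g where g: "homeomorphism {0..1} {0..1} f g"
    using f by (auto simp: Homeo01_def)
  have "inv_into {0..1} f x = g x" if "x \<in> {0..1}" for x
    by (metis g homeomorphism_def imageI inv_into_f_f Homeo01_bij_betw[OF f] bij_betw_def that)
  then show ?thesis
    using homeomorphism_cont2[OF g] continuous_on_cong[of "{0..1}" "{0..1}" "inv_into {0..1} f" g]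
    by simp
qed

lemma inv_BijGroup:
  assumes "f \<in> Bij S"
  shows "inv\<^bsub>BijGroup S\<^esub> f = restrict (inv_into S f) S"
  using assms Bij_compose_restrict_eq[OF assms] restrict_inv_into_Bij[OF assms]
  by (intro group.inv_equality[OF group_BijGroup]) (simp_all add: BijGroup_def)

lemma subgroup_Homeo01: "subgroup (carrier Homeo01) (BijGroup {0..1})"
proof (rule group.subgroupI[OF group_BijGroup])
  show "carrier Homeo01 \<subseteq> carrier (BijGroup {0..1})"
    by (auto simp: carrier_Homeo01 BijGroup_def)
  have "(\<lambda>x\<in>{0..1}. x) \<in> carrier Homeo01"
    using id_Bij by (simp add: carrier_Homeo01 del: restrict_apply)
  then show "carrier Homeo01 \<noteq> {}" by blast
next
  fix f assume f: "f \<in> carrier Homeo01"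
  then have "f \<in> Bij {0..1}" by (simp add: carrier_Homeo01)
  then show "inv\<^bsub>BijGroup {0..1}\<^esub> f \<in> carrier Homeo01"
    using Homeo01_continuous_inv_into[OF f]
    by (simp add: inv_BijGroup carrier_Homeo01 restrict_inv_into_Bij del: restrict_apply)
next
  fix f g assume f: "f \<in> carrier Homeo01" and g: "g \<in> carrier Homeo01"
  have "continuous_on {0..1} (f \<circ> g)"
    using f g Homeo01_bij_betw[OF g]
    by (intro continuous_on_compose) (auto simp: carrier_Homeo01 bij_betw_def)
  then have "continuous_on {0..1} (compose {0..1} f g)"
    by (simp add: compose_def o_def del: restrict_apply)
  then show "f \<otimes>\<^bsub>BijGroup {0..1}\<^esub> g \<in> carrier Homeo01"
    using f g by (simp add: carrier_Homeo01 BijGroup_def compose_Bij)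
qed

lemma group_Homeo01: "group Homeo01"
  using group.subgroup_imp_group[OF group_BijGroup subgroup_Homeo01] Homeo01_eq by simp

lemma one_Homeo01: "\<one>\<^bsub>Homeo01\<^esub> = (\<lambda>x\<in>{0..1}. x)"
  by (simp add: Homeo01_def BijGroup_def)

lemma mult_Homeo01:
  "f \<in> carrier Homeo01 \<Longrightarrow> g \<in> carrier Homeo01 \<Longrightarrow> f \<otimes>\<^bsub>Homeo01\<^esub> g = compose {0..1} f g"
  by (subst Homeo01_eq) (simp add: carrier_Homeo01 BijGroup_def)

lemma inv_Homeo01:
  "f \<in> carrier Homeo01 \<Longrightarrow> inv\<^bsub>Homeo01\<^esub> f = restrict (inv_into {0..1} f) {0..1}"
  using group.m_inv_consistent[OF group_BijGroup subgroup_Homeo01, of f] Homeo01_eq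
  by (simp add: inv_BijGroup carrier_Homeo01)

section \<open>Thompson's group as a group\<close>

text \<open>
  The set \<open>D\<close> may be larger than the set of true break points. This slack is what makes composition
  and inversion easy: images and preimages of break points can be added to \<open>D\<close> without asking
  whether the slopes on the two sides really differ.
\<close>

definition dyadic_affine_off :: "real set \<Rightarrow> (real \<Rightarrow> real) \<Rightarrow> bool" where
  "dyadic_affine_off D f \<longleftrightarrow> (\<forall>a b. 0 \<le> a \<and> a < b \<and> b \<le> 1 \<and> {a<..<b} \<inter> D = {} \<longrightarrow>
     (\<exists>k::int. \<forall>x\<in>{a..b}. \<forall>y\<in>{a..b}. f y - f x = 2 powi k * (y - x)))"

lemma dyadic_affine_offE:
  assumes "dyadic_affine_off D f" "0 \<le> a" "a < b" "b \<le> 1" "{a<..<b} \<inter> D = {}"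
  obtains k :: int
  where "\<And>x y. x \<in> {a..b} \<Longrightarrow> y \<in> {a..b} \<Longrightarrow> f y - f x = 2 powi k * (y - x)"
  using assms unfolding dyadic_affine_off_def by metis

lemma affine_has_derivative:
  fixes f :: "real \<Rightarrow> real"
  assumes "\<And>y. y \<in> S \<Longrightarrow> f y - f x = m * (y - x)" "x \<in> S"
  shows "(f has_real_derivative m) (at x within S)"
proof -
  have "((\<lambda>y. f x + m * (y - x)) has_real_derivative m) (at x within S)"
    by (auto intro!: derivative_eq_intros)
  then show ?thesis
    by (rule has_field_derivative_transform_within[OF _ zero_less_one assms(2)])
       (simp flip: assms(1))
qed

lemma affine_slope_eq_derivative:
  fixes f :: "real \<Rightarrow> real"
  assumes aff: "\<And>x y. x \<in> {a..b} \<Longrightarrow> y \<in> {a..b} \<Longrightarrow> f y - f x = m * (y - x)"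
    and "a < b" "z \<in> {a..b}" and d: "(f has_real_derivative d) (at z)"
  shows "d = m"
proof (rule has_field_derivative_unique)
  show "(f has_real_derivative d) (at z within {a..b})"
    using d by (rule has_field_derivative_at_within)
  show "(f has_real_derivative m) (at z within {a..b})"
    using assms by (intro affine_has_derivative) auto
  show "at z within {a..b} \<noteq> bot"
    using assms by (simp add: trivial_limit_within islimpt_Icc)
qed

text \<open>
  Piecewise linearity only provides some finite set \<open>B\<close> of possible breaks, which need not be
  dyadic. At a point of \<open>B\<close> where the derivative exists, the slopes on both sides equal that
  derivative, so the two adjacent affine pieces have the same slope and fuse into one. Hence only
  the points without derivative separate affine pieces.
\<close>

lemma Thompson_F_affine_off_break_points:
  assumes f: "f \<in> carrier Thompson_F"
  shows "dyadic_affine_off (break_points f) f"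
  unfolding dyadic_affine_off_def
proof (intro allI impI, elim conjE)
  fix a b :: real
  assume ab: "0 \<le> a" "a < b" "b \<le> 1" "{a<..<b} \<inter> break_points f = {}"
  obtain B where B: "finite B" "\<And>a b. 0 \<le> a \<Longrightarrow> a < b \<Longrightarrow> b \<le> 1 \<Longrightarrow> {a<..<b} \<inter> B = {} \<Longrightarrow>
        \<exists>m c. \<forall>x\<in>{a..b}. f x = m * x + c"
    using f unfolding Thompson_F_def piecewise_linear_def by auto
  have slope: "\<exists>k::int. (f has_real_derivative 2 powi k) (at x)"
    if "x \<in> {0<..<1}" "x \<notin> break_points f" for x
    using f that unfolding Thompson_F_def by auto
  define P where "P a b \<longleftrightarrow> (0 \<le> a \<and> a \<le> b \<and> b \<le> 1 \<and> {a<..<b} \<inter> break_points f = {} \<longrightarrow>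
     (\<exists>k::int. \<forall>x\<in>{a..b}. \<forall>y\<in>{a..b}. f y - f x = 2 powi k * (y - x)))" for a b
  have P_refl: "P x x" for x
    by (auto simp: P_def)
  have P_linear: "P a b" if "{a<..<b} \<inter> B = {}" for a b
  proof (cases "a < b \<and> 0 \<le> a \<and> b \<le> 1 \<and> {a<..<b} \<inter> break_points f = {}")
    case True
    then obtain m c where mc: "\<forall>x\<in>{a..b}. f x = m * x + c"
      using B(2) \<open>{a<..<b} \<inter> B = {}\<close> by blast
    have aff: "f y - f x = m * (y - x)" if "x \<in> {a..b}" "y \<in> {a..b}" for x y
      using that mc by (simp add: algebra_simps)
    have mid: "(a + b) / 2 \<in> {a<..<b}" using True by auto
    with True have "(a + b) / 2 \<notin> break_points f" by blast
    moreover have "(a + b) / 2 \<in> {0<..<1}" using True by auto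
    ultimately obtain k :: int where "(f has_real_derivative 2 powi k) (at ((a + b) / 2))"
      using slope by blast
    with True have "2 powi k = m"
      by (intro affine_slope_eq_derivative[OF aff, of a b]) auto
    with aff show ?thesis by (auto simp: P_def)
  next
    case False
    then show ?thesis using P_refl by (cases "a = b") (auto simp: P_def)
  qed
  \<comment> \<open>Fusing two pieces at a point \<open>b\<close> where the derivative exists; degenerate intervals carry
     no slope and are split off.\<close>
  have P_trans: "P a c" if "P a b" "P b c" "a \<le> b" "b \<le> c" for a b c
  proof (cases "a < b \<and> b < c \<and> 0 \<le> a \<and> c \<le> 1 \<and> {a<..<c} \<inter> break_points f = {}")
    case True
    then have "{a<..<b} \<subseteq> {a<..<c}" "{b<..<c} \<subseteq> {a<..<c}" by auto
    with True have disjoint: "{a<..<b} \<inter> break_points f = {}" "{b<..<c} \<inter> break_points f = {}"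
      by blast+
    have "\<exists>k::int. \<forall>x\<in>{a..b}. \<forall>y\<in>{a..b}. f y - f x = 2 powi k * (y - x)"
      using \<open>P a b\<close> True disjoint by (simp add: P_def)
    then obtain k :: int where k: "\<And>x y. x \<in> {a..b} \<Longrightarrow> y \<in> {a..b} \<Longrightarrow> f y - f x = 2 powi k * (y - x)"
      by blast
    have "\<exists>k::int. \<forall>x\<in>{b..c}. \<forall>y\<in>{b..c}. f y - f x = 2 powi k * (y - x)"
      using \<open>P b c\<close> True disjoint by (simp add: P_def)
    then obtain l :: int where l: "\<And>x y. x \<in> {b..c} \<Longrightarrow> y \<in> {b..c} \<Longrightarrow> f y - f x = 2 powi l * (y - x)"
      by blast
    have "b \<notin> break_points f" using True by auto
    then obtain d where d: "(f has_real_derivative d) (at b)"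
      using True slope[of b] by auto
    have "d = 2 powi k"
      by (rule affine_slope_eq_derivative[OF k _ _ d]) (use True in auto)
    moreover have "d = 2 powi l"
      by (rule affine_slope_eq_derivative[OF l _ _ d]) (use True in auto)
    ultimately have kl: "(2::real) powi l = 2 powi k" by simp
    have "f y - f x = 2 powi k * (y - x)" if "x \<in> {a..c}" "y \<in> {a..c}" for x y
    proof -
      have "f z - f b = 2 powi k * (z - b)" if "z \<in> {a..c}" for z
        using k[of b z] l[of b z] that True kl by (cases "z \<le> b") simp_all
      from this[OF \<open>x \<in> {a..c}\<close>] this[OF \<open>y \<in> {a..c}\<close>] show ?thesis
        by (simp add: algebra_simps)
    qed
    then show ?thesis by (auto simp: P_def)
  next
    case False
    then show ?thesis using that by (cases "a = b"; cases "b = c") (auto simp: P_def)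
  qed
  from \<open>a < b\<close> have "a \<le> b" by simp
  then have "P a b"
  proof (induction rule: Bolzano)
    case (trans a b c)
    then show ?case using P_trans by blast
  next
    case (local x)
    obtain d where d: "d > 0" "\<forall>y\<in>B. y \<noteq> x \<longrightarrow> d \<le> dist x y"
      using finite_set_avoid[OF B(1)] by blast
    have "P u v" if "u \<le> x" "x \<le> v" "v - u < d" for u v
    proof (rule P_trans[OF P_linear P_linear])
      show "{u<..<x} \<inter> B = {}" "{x<..<v} \<inter> B = {}"
        using d that by (fastforce simp: dist_real_def)+
    qed (use that in auto)
    with \<open>d > 0\<close> show ?case by blast
  qed
  then show "\<exists>k::int. \<forall>x\<in>{a..b}. \<forall>y\<in>{a..b}. f y - f x = 2 powi k * (y - x)"
    using ab by (simp add: P_def)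
qed

text \<open>
  The working description of Thompson's group. For the converse direction, a point of \<open>D\<close> at
  which the derivative happens to exist still has a power of two as its derivative, because the
  derivative equals the slope of the affine piece to its left.
\<close>

lemma Thompson_F_iff:
  "f \<in> carrier Thompson_F \<longleftrightarrow> f \<in> carrier Homeo01 \<and> strict_mono_on {0..1} f \<and>
     (\<exists>D. finite D \<and> D \<subseteq> dyadic \<and> dyadic_affine_off D f)"
proof (intro iffI conjI)
  assume f: "f \<in> carrier Thompson_F"
  then show "f \<in> carrier Homeo01" "strict_mono_on {0..1} f"
    by (simp_all add: Thompson_F_def)
  have "finite (break_points f) \<and> break_points f \<subseteq> dyadic"
    using f by (simp add: Thompson_F_def)
  with Thompson_F_affine_off_break_points[OF f]
  show "\<exists>D. finite D \<and> D \<subseteq> dyadic \<and> dyadic_affine_off D f" by blast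
next
  assume "f \<in> carrier Homeo01 \<and> strict_mono_on {0..1} f \<and>
     (\<exists>D. finite D \<and> D \<subseteq> dyadic \<and> dyadic_affine_off D f)"
  then obtain D where f: "f \<in> carrier Homeo01" "strict_mono_on {0..1} f"
    and D: "finite D" "D \<subseteq> dyadic" "dyadic_affine_off D f" by blast
  have pl: "piecewise_linear f"
    unfolding piecewise_linear_def
  proof (intro exI[of _ D] conjI allI impI; (elim conjE)?)
    fix a b :: real assume ab: "0 \<le> a" "a < b" "b \<le> 1" "{a<..<b} \<inter> D = {}"
    obtain k :: int where
      k: "\<And>x y. x \<in> {a..b} \<Longrightarrow> y \<in> {a..b} \<Longrightarrow> f y - f x = 2 powi k * (y - x)"
      using dyadic_affine_offE[OF D(3) ab] by blast
    have "f x = 2 powi k * x + (f a - 2 powi k * a)" if "x \<in> {a..b}" for x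
      using k[of a x] that ab by (simp add: algebra_simps)
    then show "\<exists>m c. \<forall>x\<in>{a..b}. f x = m * x + c" by blast
  qed (rule D)
  have neighbourhood: "\<exists>k::int. \<exists>a. 0 \<le> a \<and> a < x \<and>
      (\<forall>u\<in>{a..x}. \<forall>v\<in>{a..x}. f v - f u = 2 powi k * (v - u)) \<and>
      (x \<notin> D \<longrightarrow> (f has_real_derivative 2 powi k) (at x))" if x: "x \<in> {0<..<1}" for x
  proof -
    obtain d where d: "d > 0" "\<forall>y\<in>D. y \<noteq> x \<longrightarrow> d \<le> dist x y"
      using finite_set_avoid[OF D(1)] by blast
    define a where "a = max 0 (x - d)"
    \<comment> \<open>For \<open>x \<in> D\<close> the affine piece stops at \<open>x\<close>, and only the left-hand slope is recorded.\<close>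
    define b where "b = (if x \<in> D then x else min 1 (x + d))"
    have ab: "0 \<le> a" "a < x" "a < b" "x \<le> b" "b \<le> 1"
      using x d by (auto simp: a_def b_def)
    moreover have "{a<..<b} \<inter> D = {}"
      using d by (fastforce simp: a_def b_def dist_real_def split: if_splits)
    ultimately obtain k :: int where
      k: "\<And>x y. x \<in> {a..b} \<Longrightarrow> y \<in> {a..b} \<Longrightarrow> f y - f x = 2 powi k * (y - x)"
      using dyadic_affine_offE[OF D(3), of a b] by blast
    have "(f has_real_derivative 2 powi k) (at x)" if "x \<notin> D"
    proof -
      have "x \<in> {a<..<b}" using ab x d that by (auto simp: b_def)
      then have "(f has_real_derivative 2 powi k) (at x within {a<..<b})"
        by (intro affine_has_derivative k) auto
      then show ?thesis
        unfolding at_within_open[OF \<open>x \<in> {a<..<b}\<close> open_greaterThanLessThan] .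
    qed
    moreover have "\<forall>u\<in>{a..x}. \<forall>v\<in>{a..x}. f v - f u = 2 powi k * (v - u)"
      using ab by (intro ballI k) auto
    ultimately show ?thesis using ab by blast
  qed
  have break_D: "break_points f \<subseteq> D"
  proof
    fix x assume "x \<in> break_points f"
    then have x: "x \<in> {0<..<1}" and "\<not> f differentiable (at x)"
      by (simp_all add: break_points_def)
    with neighbourhood[OF x] show "x \<in> D"
      unfolding real_differentiable_def by blast
  qed
  have "\<exists>k::int. (f has_real_derivative 2 powi k) (at x)"
    if "x \<in> {0<..<1} - break_points f" for x
  proof -
    from that obtain d where d: "(f has_real_derivative d) (at x)"
      by (auto simp: break_points_def real_differentiable_def)
    from that neighbourhood[of x] obtain k :: int and a where "a < x" and
      k: "\<And>u v. u \<in> {a..x} \<Longrightarrow> v \<in> {a..x} \<Longrightarrow> f v - f u = 2 powi k * (v - u)"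
      by blast
    have "d = 2 powi k"
      by (rule affine_slope_eq_derivative[OF k _ _ d]) (use \<open>a < x\<close> in auto)
    with d show ?thesis by blast
  qed
  moreover have "finite (break_points f)" "break_points f \<subseteq> dyadic"
    using break_D D finite_subset by blast+
  ultimately show "f \<in> carrier Thompson_F"
    using pl f by (simp add: Thompson_F_def)
qed

lemma dyadic_zero: "0 \<in> dyadic"
  unfolding dyadic_def by (auto intro!: exI[of _ 0])

lemma dyadic_diff:
  assumes "x \<in> dyadic" "y \<in> dyadic"
  shows "x - y \<in> dyadic"
proof -
  obtain a b :: int and m n :: nat where "x = of_int a / 2 ^ m" "y = of_int b / 2 ^ n"
    using assms by (auto simp: dyadic_def)
  then have "x - y = of_int (a * 2 ^ n - b * 2 ^ m) / 2 ^ (m + n)"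
    by (simp add: diff_divide_distrib power_add)
  then show ?thesis unfolding dyadic_def by blast
qed

lemma dyadic_add:
  assumes "x \<in> dyadic" "y \<in> dyadic"
  shows "x + y \<in> dyadic"
  using dyadic_diff[OF assms(1) dyadic_diff[OF dyadic_zero assms(2)]] by simp

lemma dyadic_powi_mult:
  assumes "x \<in> dyadic"
  shows "2 powi k * x \<in> dyadic"
proof -
  obtain a :: int and m :: nat where x: "x = of_int a / 2 ^ m"
    using assms by (auto simp: dyadic_def)
  show ?thesis
  proof (cases "k \<ge> 0")
    case True
    then have "2 powi k * x = of_int (2 ^ nat k * a) / 2 ^ m"
      by (simp add: x power_int_def)
    then show ?thesis unfolding dyadic_def by blast
  next
    case False
    then have "2 powi k * x = of_int a / 2 ^ (m + nat (- k))"
      by (simp add: x power_int_def power_add field_simps)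
    then show ?thesis unfolding dyadic_def by blast
  qed
qed

text \<open>
  Elements of Thompson's group permute the dyadic points, which is why break points of composites
  and inverses stay dyadic. Start at \<open>0\<close>, which is fixed, and walk to the right: from the last
  point \<open>d\<close> of \<open>D\<close> before \<open>x\<close>, where both \<open>d\<close> and \<open>f d\<close> are dyadic already, the point \<open>f x\<close>
  differs from \<open>f d\<close> by a power of two times \<open>x - d\<close>.
\<close>

lemma dyadic_affine_off_dyadic_iff:
  assumes D: "dyadic_affine_off D f" "finite D" "D \<subseteq> dyadic" and f0: "f 0 = 0"
    and "0 \<le> x" "x \<le> 1"
  shows "f x \<in> dyadic \<longleftrightarrow> x \<in> dyadic"
  using \<open>0 \<le> x\<close> \<open>x \<le> 1\<close>
proof (induction "card (D \<inter> {0<..<x})" arbitrary: x rule: less_induct)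
  case less
  show ?case
  proof (cases "x = 0")
    case True
    then show ?thesis using f0 dyadic_zero by simp
  next
    case False
    define d where "d = Max (insert 0 (D \<inter> {0<..<x}))"
    have fin: "finite (insert 0 (D \<inter> {0<..<x}))" using D(2) by simp
    have d_cases: "d = 0 \<or> d \<in> D \<inter> {0<..<x}"
      using Max_in[OF fin] by (auto simp: d_def)
    have d: "0 \<le> d" "d < x"
      using d_cases less.prems False by auto
    have "y \<le> d" if "y \<in> D" "0 < y" "y < x" for y
      using that fin by (auto simp: d_def intro!: Max_ge)
    then have "{d<..<x} \<inter> D = {}"
      using d by fastforce
    then obtain k :: int where
      k: "\<And>u v. u \<in> {d..x} \<Longrightarrow> v \<in> {d..x} \<Longrightarrow> f v - f u = 2 powi k * (v - u)"
      using dyadic_affine_offE[OF D(1), of d x] d less.prems by blast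
    have fx: "f x - f d = 2 powi k * (x - d)" using k d by simp
    have "f d \<in> dyadic \<and> d \<in> dyadic"
    proof (cases "d = 0")
      case True
      then show ?thesis using f0 dyadic_zero by simp
    next
      case False
      then have "d \<in> D \<inter> {0<..<x}" using d_cases by simp
      then have "D \<inter> {0<..<d} \<subset> D \<inter> {0<..<x}" by auto
      then have "card (D \<inter> {0<..<d}) < card (D \<inter> {0<..<x})"
        using D(2) by (intro psubset_card_mono) auto
      then show ?thesis
        using less.hyps[of d] d less.prems D(3) \<open>d \<in> D \<inter> {0<..<x}\<close> by auto
    qed
    moreover have "f x = f d + 2 powi k * (x - d)"
      using fx by simp
    moreover have "x = d + 2 powi (- k) * (f x - f d)"
      unfolding fx by (simp add: power_int_minus flip: mult.assoc)
    ultimately show ?thesis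
      by (metis dyadic_add dyadic_diff dyadic_powi_mult)
  qed
qed

lemma strict_mono_Homeo01_zero:
  assumes "f \<in> carrier Homeo01" "strict_mono_on {0..1} f"
  shows "f 0 = 0"
proof -
  have "f 0 \<le> f (inv_into {0..1} f 0)"
    using assms Homeo01_mem(2)[OF assms(1), of 0]
    by (intro monotone_onD[OF strict_mono_on_imp_mono_on[OF assms(2)]]) auto
  then show ?thesis
    using Homeo01_mem[OF assms(1), of 0] by auto
qed

lemma strict_mono_on_inv_into:
  fixes f :: "real \<Rightarrow> real"
  assumes "f \<in> carrier Homeo01" "strict_mono_on {0..1} f"
  shows "strict_mono_on {0..1} (inv_into {0..1} f)"
proof (rule strict_mono_onI)
  fix u v :: real assume uv: "u \<in> {0..1}" "v \<in> {0..1}" "u < v"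
  show "inv_into {0..1} f u < inv_into {0..1} f v"
    using strict_mono_on_less_eq[OF assms(2), of "inv_into {0..1} f v" "inv_into {0..1} f u"]
      Homeo01_mem[OF assms(1) uv(1)] Homeo01_mem[OF assms(1) uv(2)] uv(3)
    by force
qed

lemma Thompson_F_mono: "f \<in> carrier Thompson_F \<Longrightarrow> strict_mono_on {0..1} f"
  by (simp add: Thompson_F_iff)

lemma Thompson_F_Homeo01: "f \<in> carrier Thompson_F \<Longrightarrow> f \<in> carrier Homeo01"
  by (simp add: Thompson_F_iff)

lemma Thompson_F_compose:
  assumes "f \<in> carrier Thompson_F" "g \<in> carrier Thompson_F"
  shows "compose {0..1} f g \<in> carrier Thompson_F"
  unfolding Thompson_F_iff
proof (intro conjI)
  have fH: "f \<in> carrier Homeo01" and gH: "g \<in> carrier Homeo01"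
    using assms by (simp_all add: Thompson_F_Homeo01)
  have fm: "strict_mono_on {0..1} f" and gm: "strict_mono_on {0..1} g"
    using assms by (simp_all add: Thompson_F_mono)
  show "compose {0..1} f g \<in> carrier Homeo01"
    using monoid.m_closed[OF group.is_monoid[OF group_Homeo01] fH gH]
    by (simp add: mult_Homeo01 fH gH)
  show "strict_mono_on {0..1} (compose {0..1} f g)"
  proof (rule strict_mono_onI)
    fix x y :: real assume xy: "x \<in> {0..1}" "y \<in> {0..1}" "x < y"
    have "f (g x) < f (g y)"
      using xy by (intro strict_mono_onD[OF fm] strict_mono_onD[OF gm] Homeo01_mem(1)[OF gH])
    with xy show "compose {0..1} f g x < compose {0..1} f g y"
      by (simp only: compose_eq)
  qed
  obtain C where C: "finite C" "C \<subseteq> dyadic" "dyadic_affine_off C f"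
    using assms(1) by (auto simp: Thompson_F_iff)
  obtain D where D: "finite D" "D \<subseteq> dyadic" "dyadic_affine_off D g"
    using assms(2) by (auto simp: Thompson_F_iff)
  \<comment> \<open>A composite can only break where \<open>g\<close> breaks or where \<open>g\<close> hits a break of \<open>f\<close>.\<close>
  define E where "E = D \<union> (g -` C \<inter> {0..1})"
  have "finite E"
    using D(1) finite_vimage_IntI[OF C(1) strict_mono_on_imp_inj_on[OF gm]] by (simp add: E_def)
  moreover have "E \<subseteq> dyadic"
    using dyadic_affine_off_dyadic_iff[OF D(3,1,2) strict_mono_Homeo01_zero[OF gH gm]] C(2) D(2)
    by (auto simp: E_def)
  moreover have "dyadic_affine_off E (compose {0..1} f g)"
    unfolding dyadic_affine_off_def
  proof (intro allI impI, elim conjE)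
    fix a b :: real assume ab: "0 \<le> a" "a < b" "b \<le> 1" and disj: "{a<..<b} \<inter> E = {}"
    then have "{a<..<b} \<inter> D = {}" by (auto simp: E_def)
    then obtain k :: int where
      k: "\<And>x y. x \<in> {a..b} \<Longrightarrow> y \<in> {a..b} \<Longrightarrow> g y - g x = 2 powi k * (y - x)"
      using dyadic_affine_offE[OF D(3) ab] by blast
    have g_le: "g x \<le> g y \<longleftrightarrow> x \<le> y" if "x \<in> {0..1}" "y \<in> {0..1}" for x y
      using strict_mono_on_less_eq[OF gm that] .
    have g_less: "g x < g y \<longleftrightarrow> x < y" if "x \<in> {0..1}" "y \<in> {0..1}" for x y
      using strict_mono_on_less[OF gm that] .
    have "0 \<le> g a" "g a < g b" "g b \<le> 1"
      using Homeo01_mem(1)[OF gH, of a] Homeo01_mem(1)[OF gH, of b] ab g_less[of a b] by auto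
    moreover have "{g a<..<g b} \<inter> C = {}"
    proof (rule ccontr)
      assume "{g a<..<g b} \<inter> C \<noteq> {}"
      then obtain y where y: "g a < y" "y < g b" "y \<in> C" by auto
      define x where "x = inv_into {0..1} g y"
      have "y \<in> {0..1}" using y \<open>0 \<le> g a\<close> \<open>g b \<le> 1\<close> by auto
      then have x: "x \<in> {0..1}" "g x = y"
        using Homeo01_mem[OF gH] by (auto simp: x_def)
      then have "x \<in> {a<..<b}"
        using g_less[of a x] g_less[of x b] y ab by auto
      moreover have "x \<in> E" using x y by (simp add: E_def)
      ultimately show False using disj by auto
    qed
    ultimately obtain l :: int where
      l: "\<And>x y. x \<in> {g a..g b} \<Longrightarrow> y \<in> {g a..g b} \<Longrightarrow> f y - f x = 2 powi l * (y - x)"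
      using dyadic_affine_offE[OF C(3), of "g a" "g b"] by blast
    have "compose {0..1} f g y - compose {0..1} f g x = 2 powi (l + k) * (y - x)"
      if "x \<in> {a..b}" "y \<in> {a..b}" for x y
    proof -
      have "f (g y) - f (g x) = 2 powi l * (g y - g x)"
        using that ab by (intro l) (auto simp: g_le)
      then show ?thesis
        using k[OF that] that ab by (simp add: compose_def power_int_add)
    qed
    then show "\<exists>k::int. \<forall>x\<in>{a..b}. \<forall>y\<in>{a..b}.
        compose {0..1} f g y - compose {0..1} f g x = 2 powi k * (y - x)"
      by blast
  qed
  ultimately show "\<exists>D. finite D \<and> D \<subseteq> dyadic \<and> dyadic_affine_off D (compose {0..1} f g)"
    by blast
qed

lemma Thompson_F_inverse:
  assumes "f \<in> carrier Thompson_F"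
  shows "restrict (inv_into {0..1} f) {0..1} \<in> carrier Thompson_F"
  unfolding Thompson_F_iff
proof (intro conjI)
  let ?h = "inv_into {0..1} f"
  have fH: "f \<in> carrier Homeo01" and fm: "strict_mono_on {0..1} f"
    using assms by (simp_all add: Thompson_F_Homeo01 Thompson_F_mono)
  show "restrict ?h {0..1} \<in> carrier Homeo01"
    using group.inv_closed[OF group_Homeo01 fH] by (simp add: inv_Homeo01 fH)
  have hm: "strict_mono_on {0..1} ?h"
    using strict_mono_on_inv_into[OF fH fm] .
  then show "strict_mono_on {0..1} (restrict ?h {0..1})"
    by (auto simp: monotone_on_def)
  obtain D where D: "finite D" "D \<subseteq> dyadic" "dyadic_affine_off D f"
    using assms(1) by (auto simp: Thompson_F_iff)
  define E where "E = f ` (D \<inter> {0..1})"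
  have "finite E" using D(1) by (simp add: E_def)
  moreover have "E \<subseteq> dyadic"
    using dyadic_affine_off_dyadic_iff[OF D(3,1,2) strict_mono_Homeo01_zero[OF fH fm]] D(2)
    by (auto simp: E_def)
  moreover have "dyadic_affine_off E (restrict ?h {0..1})"
    unfolding dyadic_affine_off_def
  proof (intro allI impI, elim conjE)
    fix a b :: real assume ab: "0 \<le> a" "a < b" "b \<le> 1" and disj: "{a<..<b} \<inter> E = {}"
    have h_le: "?h x \<le> ?h y \<longleftrightarrow> x \<le> y" if "x \<in> {0..1}" "y \<in> {0..1}" for x y
      using strict_mono_on_less_eq[OF hm that] .
    have f_less: "f x < f y \<longleftrightarrow> x < y" if "x \<in> {0..1}" "y \<in> {0..1}" for x y
      using strict_mono_on_less[OF fm that] .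
    have ha: "0 \<le> ?h a" "?h a \<le> 1" "f (?h a) = a" and hb: "0 \<le> ?h b" "?h b \<le> 1" "f (?h b) = b"
      using Homeo01_mem(2,3)[OF fH, of a] Homeo01_mem(2,3)[OF fH, of b] ab by auto
    have "?h a < ?h b"
      using f_less[of "?h a" "?h b"] ha hb ab by auto
    moreover have "{?h a<..<?h b} \<inter> D = {}"
    proof (rule ccontr)
      assume "{?h a<..<?h b} \<inter> D \<noteq> {}"
      then obtain x where x: "?h a < x" "x < ?h b" "x \<in> D" by auto
      then have "f x \<in> {a<..<b}"
        using f_less[of "?h a" x] f_less[of x "?h b"] ha hb by auto
      moreover have "f x \<in> E" using x ha hb by (auto simp: E_def)
      ultimately show False using disj by auto
    qed
    ultimately obtain k :: int where
      k: "\<And>x y. x \<in> {?h a..?h b} \<Longrightarrow> y \<in> {?h a..?h b} \<Longrightarrow> f y - f x = 2 powi k * (y - x)"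
      using dyadic_affine_offE[OF D(3), of "?h a" "?h b"] ha hb by blast
    have "restrict ?h {0..1} y - restrict ?h {0..1} x = 2 powi (- k) * (y - x)"
      if "x \<in> {a..b}" "y \<in> {a..b}" for x y
    proof -
      have "f (?h y) - f (?h x) = 2 powi k * (?h y - ?h x)"
        using that ab by (intro k) (auto simp: h_le)
      moreover have "f (?h y) = y" "f (?h x) = x"
        using Homeo01_mem(3)[OF fH, of x] Homeo01_mem(3)[OF fH, of y] that ab by auto
      ultimately show ?thesis
        using that ab by (simp add: power_int_minus)
    qed
    then show "\<exists>k::int. \<forall>x\<in>{a..b}. \<forall>y\<in>{a..b}.
        restrict ?h {0..1} y - restrict ?h {0..1} x = 2 powi k * (y - x)"
      by blast
  qed
  ultimately show "\<exists>D. finite D \<and> D \<subseteq> dyadic \<and> dyadic_affine_off D (restrict ?h {0..1})"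
    by blast
qed

lemma one_mem_Thompson_F: "(\<lambda>x\<in>{0..1}. x) \<in> carrier Thompson_F"
  unfolding Thompson_F_iff
proof (intro conjI)
  show "(\<lambda>x\<in>{0..1}. x) \<in> carrier Homeo01"
    using monoid.one_closed[OF group.is_monoid[OF group_Homeo01]] by (simp add: one_Homeo01)
  show "strict_mono_on {0..1} (\<lambda>x\<in>{0..1::real}. x)"
    by (auto simp: monotone_on_def)
  have "dyadic_affine_off {} (\<lambda>x\<in>{0..1}. x)"
    by (auto simp: dyadic_affine_off_def intro!: exI[of _ 0])
  then show "\<exists>D. finite D \<and> D \<subseteq> dyadic \<and> dyadic_affine_off D (\<lambda>x\<in>{0..1}. x)"
    by blast
qed

lemma Thompson_F_eq: "Thompson_F = Homeo01 \<lparr>carrier := carrier Thompson_F\<rparr>"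
  by (simp add: Thompson_F_def)

lemma subgroup_Thompson_F: "subgroup (carrier Thompson_F) Homeo01"
proof (rule group.subgroupI[OF group_Homeo01])
  show "carrier Thompson_F \<subseteq> carrier Homeo01"
    by (auto simp: Thompson_F_Homeo01)
  show "carrier Thompson_F \<noteq> {}"
    using one_mem_Thompson_F by blast
qed (simp_all add: inv_Homeo01 mult_Homeo01 Thompson_F_Homeo01 Thompson_F_inverse Thompson_F_compose)

lemma group_Thompson_F: "group Thompson_F"
  using group.subgroup_imp_group[OF group_Homeo01 subgroup_Thompson_F] Thompson_F_eq by simp

lemma mult_Thompson_F:
  assumes "f \<in> carrier Thompson_F" "g \<in> carrier Thompson_F"
  shows "f \<otimes>\<^bsub>Thompson_F\<^esub> g = compose {0..1} f g"
  using mult_Homeo01[of f g] assms by (subst Thompson_F_eq) (simp add: Thompson_F_Homeo01)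

lemma one_Thompson_F: "\<one>\<^bsub>Thompson_F\<^esub> = (\<lambda>x\<in>{0..1}. x)"
  using one_Homeo01 by (subst Thompson_F_eq) simp

lemma inv_Thompson_F:
  assumes "f \<in> carrier Thompson_F"
  shows "inv\<^bsub>Thompson_F\<^esub> f = restrict (inv_into {0..1} f) {0..1}"
  using group.m_inv_consistent[OF group_Homeo01 subgroup_Thompson_F assms] Thompson_F_eq
  by (simp add: inv_Homeo01 Thompson_F_Homeo01 assms)

section \<open>The measure of the set of disagreement\<close>

definition disagree :: "(real \<Rightarrow> real) \<Rightarrow> (real \<Rightarrow> real) \<Rightarrow> real" where
  "disagree f g = measure lebesgue {x \<in> {0..1}. f x \<noteq> g x}"

lemma lmeasurable_disagree:
  fixes f g :: "real \<Rightarrow> real"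
  assumes "continuous_on {0..1} f" "continuous_on {0..1} g"
  shows "{x \<in> {0..1}. f x \<noteq> g x} \<in> lmeasurable"
proof -
  have "closed {x \<in> {0..1}. f x - g x = 0}"
    using assms by (intro continuous_closed_preimage_constant continuous_intros) auto
  then have "compact {x \<in> {0..1}. f x - g x = 0}"
    by (auto simp: compact_eq_bounded_closed intro: bounded_subset[OF bounded_closed_interval])
  then have "{0..1} - {x \<in> {0..1}. f x - g x = 0} \<in> lmeasurable"
    by (intro fmeasurable.Diff lmeasurable_compact) auto
  moreover have "{0..1} - {x \<in> {0..1}. f x - g x = 0} = {x \<in> {0..1}. f x \<noteq> g x}"
    by auto
  ultimately show ?thesis by simp
qed

lemma disagree_nonneg [simp]: "0 \<le> disagree f g"
  by (simp add: disagree_def)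

lemma disagree_commute: "disagree f g = disagree g f"
  unfolding disagree_def by (intro arg_cong[where f = "measure lebesgue"]) auto

lemma disagree_cong:
  assumes "\<And>x. x \<in> {0..1} \<Longrightarrow> f x = f' x" "\<And>x. x \<in> {0..1} \<Longrightarrow> g x = g' x"
  shows "disagree f g = disagree f' g'"
  unfolding disagree_def using assms by (intro arg_cong[where f = "measure lebesgue"]) auto

lemma disagree_triangle:
  assumes "continuous_on {0..1} f" "continuous_on {0..1} g" "continuous_on {0..1} h"
  shows "disagree f h \<le> disagree f g + disagree g h"
proof -
  note meas = lmeasurable_disagree[OF assms(1,2)] lmeasurable_disagree[OF assms(2,3)]
    lmeasurable_disagree[OF assms(1,3)]
  have "disagree f h \<le> measure lebesgue ({x \<in> {0..1}. f x \<noteq> g x} \<union> {x \<in> {0..1}. g x \<noteq> h x})"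
    unfolding disagree_def using meas
    by (intro measure_mono_fmeasurable fmeasurable.Un) (auto dest: fmeasurableD)
  also have "\<dots> \<le> disagree f g + disagree g h"
    unfolding disagree_def using meas by (intro measure_Un_le) (auto dest: fmeasurableD)
  finally show ?thesis .
qed

text \<open>
  If \<open>f x < g x\<close>, then every \<open>y\<close> strictly between these values satisfies
  \<open>g\<^sup>-\<^sup>1 y < x < f\<^sup>-\<^sup>1 y\<close>. So the inverses disagree on an interval of length \<open>g x - f x\<close>: the
  measure of disagreement of the inverses bounds the uniform distance of the maps.
\<close>

lemma abs_diff_le_disagree_inv:
  assumes "f \<in> carrier Homeo01" "strict_mono_on {0..1} f"
    and "g \<in> carrier Homeo01" "strict_mono_on {0..1} g" and x: "x \<in> {0..1}"
  shows "\<bar>f x - g x\<bar> \<le> disagree (inv_into {0..1} f) (inv_into {0..1} g)"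
proof -
  have *: "g x - f x \<le> disagree (inv_into {0..1} f) (inv_into {0..1} g)"
    if f: "f \<in> carrier Homeo01" "strict_mono_on {0..1} f"
      and g: "g \<in> carrier Homeo01" "strict_mono_on {0..1} g" for f g
  proof (cases "f x < g x")
    case True
    have "inv_into {0..1} f y \<noteq> inv_into {0..1} g y" "y \<in> {0..1}"
      if y: "f x < y" "y < g x" for y
    proof -
      show "y \<in> {0..1}"
        using y Homeo01_mem(1)[OF f(1) x] Homeo01_mem(1)[OF g(1) x] by auto
      then have "inv_into {0..1} g y < x" "x < inv_into {0..1} f y"
        using strict_mono_on_less[OF strict_mono_on_inv_into[OF g], of y "g x"]
          strict_mono_on_less[OF strict_mono_on_inv_into[OF f], of "f x" y]
          y x Homeo01_mem[OF f(1) x] Homeo01_mem[OF g(1) x] by auto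
      then show "inv_into {0..1} f y \<noteq> inv_into {0..1} g y" by simp
    qed
    then have "{f x<..<g x} \<subseteq> {y \<in> {0..1}. inv_into {0..1} f y \<noteq> inv_into {0..1} g y}"
      by auto
    then have "measure lebesgue {f x<..<g x} \<le> disagree (inv_into {0..1} f) (inv_into {0..1} g)"
      unfolding disagree_def using f g
      by (intro measure_mono_fmeasurable lmeasurable_disagree Homeo01_continuous_inv_into) auto
    with True show ?thesis by simp
  next
    case False
    then show ?thesis using disagree_nonneg[of "inv_into {0..1} f" "inv_into {0..1} g"] by linarith
  qed
  show ?thesis
    using *[OF assms(1-4)] *[OF assms(3,4,1,2)]
      disagree_commute[of "inv_into {0..1} f" "inv_into {0..1} g"] by linarith
qed

section \<open>Expansion bounds for elements of Thompson's group\<close>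

text \<open>
  The constant is a lower bound for the finitely many slopes. It is found by bisection: the
  existence of a constant is clear on a small interval around any point, and the smaller of two
  constants serves on the union of adjacent intervals.
\<close>

lemma Thompson_F_expansion:
  assumes "f \<in> carrier Thompson_F"
  obtains c where "c > 0"
    and "\<And>x y. x \<in> {0..1} \<Longrightarrow> y \<in> {0..1} \<Longrightarrow> x \<le> y \<Longrightarrow> c * (y - x) \<le> f y - f x"
proof -
  obtain D where D: "finite D" "dyadic_affine_off D f"
    using assms(1) by (auto simp: Thompson_F_iff)
  define P where "P a b \<longleftrightarrow> (0 \<le> a \<and> b \<le> 1 \<longrightarrow>
      (\<exists>c>0. \<forall>x\<in>{a..b}. \<forall>y\<in>{a..b}. x \<le> y \<longrightarrow> c * (y - x) \<le> f y - f x))" for a b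
  have P_trans: "P a c" if "P a b" "P b c" "a \<le> b" "b \<le> c" for a b c
  proof (cases "0 \<le> a \<and> c \<le> 1")
    case True
    have "\<exists>m>0. \<forall>x\<in>{a..b}. \<forall>y\<in>{a..b}. x \<le> y \<longrightarrow> m * (y - x) \<le> f y - f x"
      using that True by (simp add: P_def)
    then obtain m where m: "m > 0"
      "\<And>x y. a \<le> x \<Longrightarrow> x \<le> y \<Longrightarrow> y \<le> b \<Longrightarrow> m * (y - x) \<le> f y - f x"
      by (meson atLeastAtMost_iff order_trans)
    have "\<exists>n>0. \<forall>x\<in>{b..c}. \<forall>y\<in>{b..c}. x \<le> y \<longrightarrow> n * (y - x) \<le> f y - f x"
      using that True by (simp add: P_def)
    then obtain n where n: "n > 0"
      "\<And>x y. b \<le> x \<Longrightarrow> x \<le> y \<Longrightarrow> y \<le> c \<Longrightarrow> n * (y - x) \<le> f y - f x"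
      by (meson atLeastAtMost_iff order_trans)
    have "min m n * (y - x) \<le> f y - f x" if xy: "a \<le> x" "x \<le> y" "y \<le> c" for x y
    proof -
      have le: "min m n * (v - u) \<le> m * (v - u)" "min m n * (v - u) \<le> n * (v - u)" if "u \<le> v" for u v
        using that by (auto intro!: mult_right_mono)
      consider "y \<le> b" | "b \<le> x" | "x \<le> b" "b \<le> y" by linarith
      then show ?thesis
      proof cases
        case 1
        then show ?thesis using m(2)[of x y] le(1)[of x y] xy by linarith
      next
        case 2
        then show ?thesis using n(2)[of x y] le(2)[of x y] xy by linarith
      next
        case 3
        have "min m n * (y - x) = min m n * (b - x) + min m n * (y - b)"
          by (simp add: algebra_simps)
        also have "\<dots> \<le> (f b - f x) + (f y - f b)"
          using m(2)[of x b] le(1)[of x b] n(2)[of b y] le(2)[of b y] xy 3 by linarith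
        finally show ?thesis by simp
      qed
    qed
    moreover have "min m n > 0" using m n by simp
    ultimately show ?thesis unfolding P_def by (meson atLeastAtMost_iff)
  qed (auto simp: P_def)
  have P_affine: "P a b" if disj: "{a<..<b} \<inter> D = {}" for a b
  proof (cases "0 \<le> a \<and> a < b \<and> b \<le> 1")
    case True
    then obtain k :: int where
      "\<And>x y. x \<in> {a..b} \<Longrightarrow> y \<in> {a..b} \<Longrightarrow> f y - f x = 2 powi k * (y - x)"
      using dyadic_affine_offE[OF D(2) _ _ _ disj] by blast
    then show ?thesis unfolding P_def by (intro impI exI[of _ "2 powi k"]) simp
  next
    case False
    then have "a \<ge> b \<or> \<not> (0 \<le> a \<and> b \<le> 1)" by linarith
    show ?thesis unfolding P_def
    proof (intro impI exI[of _ 1] conjI ballI)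
      fix x y assume "0 \<le> a \<and> b \<le> 1" "x \<in> {a..b}" "y \<in> {a..b}" "x \<le> y"
      with \<open>a \<ge> b \<or> \<not> (0 \<le> a \<and> b \<le> 1)\<close> have "x = y" by auto
      then show "1 * (y - x) \<le> f y - f x" by simp
    qed simp
  qed
  have "(0::real) \<le> 1" by simp
  then have "P 0 1"
  proof (induction rule: Bolzano)
    case (trans a b c)
    then show ?case using P_trans by blast
  next
    case (local x)
    obtain d where d: "d > 0" "\<forall>y\<in>D. y \<noteq> x \<longrightarrow> d \<le> dist x y"
      using finite_set_avoid[OF D(1)] by blast
    have "P u v" if "u \<le> x" "x \<le> v" "v - u < d" for u v
    proof (rule P_trans[OF P_affine P_affine])
      show "{u<..<x} \<inter> D = {}" "{x<..<v} \<inter> D = {}"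
        using d that by (fastforce simp: dist_real_def)+
    qed (use that in auto)
    with \<open>d > 0\<close> show ?case by blast
  qed
  then show thesis using that by (auto simp: P_def)
qed

text \<open>
  Change of variables: away from finitely many points the derivative is at least \<open>c\<close>, and its
  integral over \<open>S\<close> is the measure of the image.
\<close>

lemma expansion_measure_image:
  fixes f :: "real \<Rightarrow> real"
  assumes "c > 0" and expand: "\<And>x y. x \<in> {0..1} \<Longrightarrow> y \<in> {0..1} \<Longrightarrow> x \<le> y \<Longrightarrow> c * (y - x) \<le> f y - f x"
    and B: "finite B" "\<And>x. x \<in> {0<..<1} - B \<Longrightarrow> f differentiable (at x)"
    and S: "S \<subseteq> {0..1}" "S \<in> lmeasurable" "f ` S \<in> lmeasurable"
  shows "c * measure lebesgue S \<le> measure lebesgue (f ` S)"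
proof -
  define T where "T = S - (B \<union> {0,1})"
  have neg: "negligible (B \<union> {0,1})" "negligible (f ` (B \<union> {0,1}))"
    using B(1) by (auto intro!: negligible_finite)
  have inj: "inj_on f {0..1}"
  proof (rule linorder_inj_onI)
    fix x y :: real assume "x < y" "x \<in> {0..1}" "y \<in> {0..1}"
    moreover from this \<open>c > 0\<close> have "0 < c * (y - x)" by simp
    ultimately show "f x \<noteq> f y" using expand[of x y] by force
  qed auto
  have T: "T \<in> lmeasurable"
    unfolding T_def using S(2) neg(1) by (rule fmeasurable.Diff[OF _ negligible_imp_measurable])
  have measure_T: "measure lebesgue T = measure lebesgue S"
  proof (rule measure_negligible_symdiff)
    show "negligible ((S - T) \<union> (T - S))"
      by (rule negligible_subset[OF neg(1)]) (auto simp: T_def)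
  qed (use S in auto)
  have fT: "f ` T \<in> lmeasurable" "measure lebesgue (f ` T) \<le> measure lebesgue (f ` S)"
  proof -
    have *: "f ` T = f ` S - f ` (S \<inter> (B \<union> {0,1}))"
      unfolding T_def using inj S(1) by (auto simp: inj_on_def)
    have "negligible (f ` (S \<inter> (B \<union> {0,1})))"
      by (rule negligible_subset[OF neg(2)]) auto
    then show "f ` T \<in> lmeasurable"
      unfolding * using S(3) by (intro fmeasurable.Diff[OF _ negligible_imp_measurable])
    then show "measure lebesgue (f ` T) \<le> measure lebesgue (f ` S)"
      using S by (intro measure_mono_fmeasurable) (auto simp: T_def)
  qed
  have T_sub: "x \<in> {0<..<1} - B" if "x \<in> T" for x
    using that S(1) by (auto simp: T_def less_le)
  have der: "(f has_real_derivative deriv f x) (at x)" if "x \<in> T" for x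
    using B(2)[OF T_sub[OF that]] by (metis DERIV_deriv_iff_real_differentiable)
  \<comment> \<open>Expansion says that \<open>f x - c * x\<close> is increasing.\<close>
  have der_ge: "c \<le> deriv f x" if "x \<in> T" for x
  proof -
    have "mono_on {0..1} (\<lambda>x. f x - c * x)"
      using expand by (intro mono_onI) (force simp: algebra_simps)
    moreover have "((\<lambda>x. f x - c * x) has_real_derivative (deriv f x - c)) (at x)"
      using der[OF that] by (auto intro!: derivative_eq_intros)
    moreover have "x \<in> interior {0..1}"
      using T_sub[OF that] by simp
    ultimately have "0 \<le> deriv f x - c"
      by (rule mono_on_imp_deriv_nonneg)
    then show ?thesis by simp
  qed
  have "(\<lambda>x. 1::real) absolutely_integrable_on f ` T \<and> integral (f ` T) (\<lambda>x. 1::real) = measure lebesgue (f ` T)"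
    using fT(1) lmeasure_integral[OF fT(1)] by (simp add: lmeasurable_iff_integrable set_integrable_def)
  moreover have "(f has_field_derivative deriv f x) (at x within T)" if "x \<in> T" for x
    using der[OF that] by (rule has_field_derivative_at_within)
  moreover have "inj_on f T"
    by (rule inj_on_subset[OF inj]) (use S(1) in \<open>auto simp: T_def\<close>)
  ultimately have cov: "(\<lambda>x. \<bar>deriv f x\<bar> * 1) absolutely_integrable_on T"
      "integral T (\<lambda>x. \<bar>deriv f x\<bar> * 1) = measure lebesgue (f ` T)"
    using has_absolute_integral_change_of_variables_1'[of T f "deriv f" "\<lambda>x. 1" "measure lebesgue (f ` T)"]
      fmeasurableD[OF T(1)] by auto
  have "c * measure lebesgue S = integral T (\<lambda>x. c)"
    using T measure_T lmeasure_integral[OF T(1)] integral_mult_right[of T c "\<lambda>x. 1"] by simp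
  also have "\<dots> \<le> integral T (\<lambda>x. \<bar>deriv f x\<bar> * 1)"
    using cov(1) T(1) der_ge
    by (intro integral_le integrable_on_const set_lebesgue_integral_eq_integral(1)) force+
  finally show ?thesis using cov(2) fT(2) by simp
qed

section \<open>Continuity of multiplication along Cauchy sequences\<close>

abbreviation mult_F :: "(real \<Rightarrow> real) \<Rightarrow> (real \<Rightarrow> real) \<Rightarrow> real \<Rightarrow> real" (infixl \<open>\<cdot>\<close> 70)
  where "f \<cdot> g \<equiv> f \<otimes>\<^bsub>Thompson_F\<^esub> g"

abbreviation inv_F :: "(real \<Rightarrow> real) \<Rightarrow> real \<Rightarrow> real"
  where "inv_F f \<equiv> inv\<^bsub>Thompson_F\<^esub> f"

lemma mult_F_apply:
  "f \<in> carrier Thompson_F \<Longrightarrow> g \<in> carrier Thompson_F \<Longrightarrow> x \<in> {0..1} \<Longrightarrow> (f \<cdot> g) x = f (g x)"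
  by (simp add: mult_Thompson_F compose_def)

lemma inv_F_apply:
  "f \<in> carrier Thompson_F \<Longrightarrow> x \<in> {0..1} \<Longrightarrow> inv_F f x = inv_into {0..1} f x"
  by (simp add: inv_Thompson_F)

lemmas mult_F_closed = monoid.m_closed[OF group.is_monoid[OF group_Thompson_F]]
lemmas inv_F_closed = group.inv_closed[OF group_Thompson_F]

lemma Thompson_F_continuous: "f \<in> carrier Thompson_F \<Longrightarrow> continuous_on {0..1} f"
  using Thompson_F_Homeo01 by (auto simp: carrier_Homeo01)

lemma dist_H_eq:
  assumes "f \<in> carrier Thompson_F" "g \<in> carrier Thompson_F"
  shows "dist_H f g = disagree f g + disagree (inv_F f) (inv_F g)"
proof -
  have "disagree (inv_F f) (inv_F g) = disagree (inv_into {0..1} f) (inv_into {0..1} g)"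
    using assms by (intro disagree_cong) (simp_all add: inv_F_apply)
  then show ?thesis by (simp add: dist_H_def disagree_def)
qed

lemma dist_H_nonneg [simp]: "0 \<le> dist_H f g"
  by (simp add: dist_H_def)

lemma dist_H_self [simp]: "dist_H f f = 0"
  by (simp add: dist_H_def)

lemma dist_H_commute: "dist_H f g = dist_H g f"
  using disagree_commute[of f g] disagree_commute[of "inv_into {0..1} f" "inv_into {0..1} g"]
  by (simp add: dist_H_def disagree_def)

lemma dist_H_triangle:
  assumes "f \<in> carrier Thompson_F" "g \<in> carrier Thompson_F" "h \<in> carrier Thompson_F"
  shows "dist_H f h \<le> dist_H f g + dist_H g h"
proof -
  have "disagree f h \<le> disagree f g + disagree g h"
    using assms by (intro disagree_triangle Thompson_F_continuous)
  moreover have "disagree (inv_F f) (inv_F h) \<le>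
      disagree (inv_F f) (inv_F g) + disagree (inv_F g) (inv_F h)"
    using assms by (intro disagree_triangle Thompson_F_continuous inv_F_closed)
  ultimately show ?thesis using assms by (simp add: dist_H_eq)
qed

lemma dist_H_inv:
  assumes "f \<in> carrier Thompson_F" "g \<in> carrier Thompson_F"
  shows "dist_H (inv_F f) (inv_F g) = dist_H f g"
  using assms by (simp add: dist_H_eq group.inv_inv[OF group_Thompson_F] inv_F_closed)

text \<open>
  Where \<open>q\<close>, \<open>q'\<close> and \<open>g\<close> agree, \<open>p \<cdot> q\<close> and \<open>p' \<cdot> q'\<close> can only differ at points that \<open>g\<close> maps
  into the disagreement set of \<open>p\<close> and \<open>p'\<close>. The preimage under \<open>g\<close> of a set is larger than the
  set by at most a constant factor. The point of the lemma is that this constant depends on the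
  reference element \<open>g\<close> alone: the slopes of \<open>q\<close> may be arbitrarily small, and no constant works
  for all of Thompson's group.
\<close>

lemma disagree_mult:
  assumes g: "g \<in> carrier Thompson_F"
  obtains C where "C > 0" and
    "\<And>p p' q q'. p \<in> carrier Thompson_F \<Longrightarrow> p' \<in> carrier Thompson_F \<Longrightarrow>
       q \<in> carrier Thompson_F \<Longrightarrow> q' \<in> carrier Thompson_F \<Longrightarrow>
       disagree (p \<cdot> q) (p' \<cdot> q') \<le> disagree q g + C * disagree p p' + disagree q q'"
proof -
  obtain c where c: "c > 0"
    "\<And>x y. x \<in> {0..1} \<Longrightarrow> y \<in> {0..1} \<Longrightarrow> x \<le> y \<Longrightarrow> c * (y - x) \<le> g y - g x"
    using Thompson_F_expansion[OF g] by blast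
  have gH: "g \<in> carrier Homeo01" using g by (rule Thompson_F_Homeo01)
  have breaks: "finite (break_points g)"
    "\<And>x. x \<in> {0<..<1} - break_points g \<Longrightarrow> g differentiable (at x)"
    using g by (auto simp: Thompson_F_def break_points_def)
  have bound: "disagree (p \<cdot> q) (p' \<cdot> q') \<le>
      disagree q g + inverse c * disagree p p' + disagree q q'"
    if F: "p \<in> carrier Thompson_F" "p' \<in> carrier Thompson_F"
      "q \<in> carrier Thompson_F" "q' \<in> carrier Thompson_F" for p p' q q'
  proof -
    note cont = Thompson_F_continuous[OF F(1)] Thompson_F_continuous[OF F(2)]
      Thompson_F_continuous[OF F(3)] Thompson_F_continuous[OF F(4)] Thompson_F_continuous[OF g]
    define S where "S = {x \<in> {0..1}. (p \<cdot> g) x \<noteq> (p' \<cdot> g) x}"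
    have S: "S \<in> lmeasurable"
      unfolding S_def using F g by (intro lmeasurable_disagree Thompson_F_continuous mult_F_closed)
    have image: "g ` S = {y \<in> {0..1}. p y \<noteq> p' y}"
    proof (intro equalityI subsetI)
      fix y assume "y \<in> {y \<in> {0..1}. p y \<noteq> p' y}"
      then have y: "y \<in> {0..1}" "p y \<noteq> p' y" by auto
      let ?x = "inv_into {0..1} g y"
      have x: "?x \<in> {0..1}" "g ?x = y"
        using Homeo01_mem(2,3)[OF gH y(1)] .
      moreover from this y(2) F g have "(p \<cdot> g) ?x \<noteq> (p' \<cdot> g) ?x"
        by (simp only: mult_F_apply simp_thms)
      ultimately have "?x \<in> S" by (simp only: S_def mem_Collect_eq simp_thms)
      with x(2) show "y \<in> g ` S" by (metis imageI)
    next
      fix y assume "y \<in> g ` S"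
      then obtain x where x: "x \<in> {0..1}" "(p \<cdot> g) x \<noteq> (p' \<cdot> g) x" "y = g x"
        by (auto simp: S_def)
      with F g Homeo01_mem(1)[OF gH x(1)] show "y \<in> {y \<in> {0..1}. p y \<noteq> p' y}"
        by (simp add: mult_F_apply)
    qed
    have "c * measure lebesgue S \<le> measure lebesgue (g ` S)"
    proof (rule expansion_measure_image[OF c breaks])
      show "S \<subseteq> {0..1}" by (auto simp: S_def)
      show "g ` S \<in> lmeasurable" unfolding image using cont by (intro lmeasurable_disagree)
    qed (use S in auto)
    then have "measure lebesgue S \<le> inverse c * disagree p p'"
      using c(1) by (simp add: image disagree_def field_simps)
    have "disagree (p \<cdot> q) (p' \<cdot> q') \<le> measure lebesgue
        ({x \<in> {0..1}. q x \<noteq> g x} \<union> S \<union> {x \<in> {0..1}. q x \<noteq> q' x})"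
      unfolding disagree_def
    proof (rule measure_mono_fmeasurable)
      show "{x \<in> {0..1}. (p \<cdot> q) x \<noteq> (p' \<cdot> q') x}
          \<subseteq> {x \<in> {0..1}. q x \<noteq> g x} \<union> S \<union> {x \<in> {0..1}. q x \<noteq> q' x}"
        using F g by (auto simp: S_def mult_F_apply)
      show "{x \<in> {0..1}. (p \<cdot> q) x \<noteq> (p' \<cdot> q') x} \<in> sets lebesgue"
        using F by (intro fmeasurableD lmeasurable_disagree Thompson_F_continuous mult_F_closed)
      show "{x \<in> {0..1}. q x \<noteq> g x} \<union> S \<union> {x \<in> {0..1}. q x \<noteq> q' x} \<in> lmeasurable"
        using S cont by (intro fmeasurable.Un lmeasurable_disagree)
    qed
    also have "\<dots> \<le> measure lebesgue ({x \<in> {0..1}. q x \<noteq> g x} \<union> S) + disagree q q'"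
      unfolding disagree_def
      using S cont by (intro measure_Un_le fmeasurableD fmeasurable.Un lmeasurable_disagree)
    also have "measure lebesgue ({x \<in> {0..1}. q x \<noteq> g x} \<union> S) \<le> disagree q g + measure lebesgue S"
      unfolding disagree_def using S cont by (intro measure_Un_le fmeasurableD lmeasurable_disagree)
    finally show ?thesis using \<open>measure lebesgue S \<le> inverse c * disagree p p'\<close> by linarith
  qed
  show thesis by (rule that[OF _ bound]) (use c(1) in simp)
qed

text \<open>
  Two applications of the previous estimate: to the products with reference \<open>g\<close>, and to their
  inverses, where the factors change places, with reference \<open>f\<^sup>-\<^sup>1\<close>.
\<close>

lemma dist_H_mult:
  assumes f: "f \<in> carrier Thompson_F" and g: "g \<in> carrier Thompson_F"
  obtains C where "C > 0" and
    "\<And>p p' q q'. p \<in> carrier Thompson_F \<Longrightarrow> p' \<in> carrier Thompson_F \<Longrightarrow>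
       q \<in> carrier Thompson_F \<Longrightarrow> q' \<in> carrier Thompson_F \<Longrightarrow>
       dist_H (p \<cdot> q) (p' \<cdot> q') \<le> dist_H p f + dist_H q g + C * (dist_H p p' + dist_H q q')"
proof -
  obtain A where A: "A > 0"
    "\<And>p p' q q'. p \<in> carrier Thompson_F \<Longrightarrow> p' \<in> carrier Thompson_F \<Longrightarrow>
       q \<in> carrier Thompson_F \<Longrightarrow> q' \<in> carrier Thompson_F \<Longrightarrow>
       disagree (p \<cdot> q) (p' \<cdot> q') \<le> disagree q g + A * disagree p p' + disagree q q'"
    using disagree_mult[OF g] by blast
  obtain B where B: "B > 0"
    "\<And>p p' q q'. p \<in> carrier Thompson_F \<Longrightarrow> p' \<in> carrier Thompson_F \<Longrightarrow>
       q \<in> carrier Thompson_F \<Longrightarrow> q' \<in> carrier Thompson_F \<Longrightarrow>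
       disagree (p \<cdot> q) (p' \<cdot> q') \<le> disagree q (inv_F f) + B * disagree p p' + disagree q q'"
    using disagree_mult[OF inv_F_closed[OF f]] by blast
  have bound: "dist_H (p \<cdot> q) (p' \<cdot> q') \<le>
      dist_H p f + dist_H q g + (A + B + 1) * (dist_H p p' + dist_H q q')"
    if F: "p \<in> carrier Thompson_F" "p' \<in> carrier Thompson_F"
      "q \<in> carrier Thompson_F" "q' \<in> carrier Thompson_F" for p p' q q'
  proof -
    note F' = inv_F_closed[OF F(1)] inv_F_closed[OF F(2)] inv_F_closed[OF F(3)] inv_F_closed[OF F(4)]
    let ?C = "A + B + 1"
    have weaken: "A * disagree u v \<le> ?C * disagree u v" "B * disagree u v \<le> ?C * disagree u v"
      "disagree u v \<le> ?C * disagree u v" for u v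
      using A(1) B(1) mult_right_mono[of 1 ?C "disagree u v"] by (auto intro!: mult_right_mono)
    have "disagree (p \<cdot> q) (p' \<cdot> q') \<le> disagree q g + ?C * disagree p p' + ?C * disagree q q'"
      using A(2)[OF F] weaken(1)[of p p'] weaken(3)[of q q'] by linarith
    moreover have "disagree (inv_F (p \<cdot> q)) (inv_F (p' \<cdot> q')) \<le> disagree (inv_F p) (inv_F f)
        + ?C * disagree (inv_F q) (inv_F q') + ?C * disagree (inv_F p) (inv_F p')"
      using B(2)[OF F'(3,4,1,2)] weaken(2)[of "inv_F q" "inv_F q'"] weaken(3)[of "inv_F p" "inv_F p'"]
      by (simp add: group.inv_mult_group[OF group_Thompson_F] F)
    moreover have "disagree q g \<le> dist_H q g" "disagree (inv_F p) (inv_F f) \<le> dist_H p f"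
      using F f g by (simp_all add: dist_H_eq)
    moreover have "dist_H (p \<cdot> q) (p' \<cdot> q') =
        disagree (p \<cdot> q) (p' \<cdot> q') + disagree (inv_F (p \<cdot> q)) (inv_F (p' \<cdot> q'))"
      using F by (intro dist_H_eq mult_F_closed)
    moreover have "?C * (dist_H p p' + dist_H q q') =
        ?C * disagree p p' + ?C * disagree (inv_F p) (inv_F p') +
        (?C * disagree q q' + ?C * disagree (inv_F q) (inv_F q'))"
      using F by (simp add: dist_H_eq distrib_left)
    ultimately show ?thesis by linarith
  qed
  show thesis by (rule that[OF _ bound]) (use A(1) B(1) in simp)
qed

lemma Cauchy_F_mem: "f \<in> Cauchy_F \<Longrightarrow> f n \<in> carrier Thompson_F"
  by (simp add: Cauchy_F_def)

lemma Cauchy_FD: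
  assumes "f \<in> Cauchy_F" "e > 0"
  obtains N where "\<And>m n. m \<ge> N \<Longrightarrow> n \<ge> N \<Longrightarrow> dist_H (f m) (f n) < e"
  using assms unfolding Cauchy_F_def by blast

lemma const_in_Cauchy_F: "f \<in> carrier Thompson_F \<Longrightarrow> (\<lambda>n. f) \<in> Cauchy_F"
  by (simp add: Cauchy_F_def)

lemma inv_in_Cauchy_F: "f \<in> Cauchy_F \<Longrightarrow> (\<lambda>n. inv_F (f n)) \<in> Cauchy_F"
  by (simp add: Cauchy_F_def dist_H_inv inv_F_closed)

text \<open>
  Uniform continuity of the multiplication along two Cauchy sequences. The reference elements are
  terms of the sequences so late that all later terms are within \<open>e / 4\<close> of them; the constant
  then depends on \<open>e\<close> and the two sequences only.
\<close>

lemma Cauchy_F_mult_uniform: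
  assumes f: "f \<in> Cauchy_F" and g: "g \<in> Cauchy_F" and "e > 0"
  shows "\<exists>N. \<exists>d>0. \<forall>n\<ge>N. \<forall>p\<in>carrier Thompson_F. \<forall>q\<in>carrier Thompson_F.
    dist_H (f n) p < d \<longrightarrow> dist_H (g n) q < d \<longrightarrow> dist_H (f n \<cdot> g n) (p \<cdot> q) < e"
proof -
  have "e / 4 > 0" using \<open>e > 0\<close> by simp
  obtain M where M: "\<And>m n. m \<ge> M \<Longrightarrow> n \<ge> M \<Longrightarrow> dist_H (f m) (f n) < e / 4"
    using Cauchy_FD[OF f \<open>e / 4 > 0\<close>] by blast
  obtain N where N: "\<And>m n. m \<ge> N \<Longrightarrow> n \<ge> N \<Longrightarrow> dist_H (g m) (g n) < e / 4"
    using Cauchy_FD[OF g \<open>e / 4 > 0\<close>] by blast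
  let ?K = "max M N"
  obtain C where C: "C > 0"
    "\<And>p p' q q'. p \<in> carrier Thompson_F \<Longrightarrow> p' \<in> carrier Thompson_F \<Longrightarrow>
       q \<in> carrier Thompson_F \<Longrightarrow> q' \<in> carrier Thompson_F \<Longrightarrow>
       dist_H (p \<cdot> q) (p' \<cdot> q') \<le>
         dist_H p (f ?K) + dist_H q (g ?K) + C * (dist_H p p' + dist_H q q')"
    using dist_H_mult[OF Cauchy_F_mem[OF f] Cauchy_F_mem[OF g]] by blast
  show ?thesis
  proof (intro exI[of _ ?K] exI[of _ "e / (4 * C)"] conjI allI ballI impI)
    show "e / (4 * C) > 0" using \<open>e > 0\<close> C(1) by simp
    fix n p q assume n: "n \<ge> ?K" and pq: "p \<in> carrier Thompson_F" "q \<in> carrier Thompson_F"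
      and d: "dist_H (f n) p < e / (4 * C)" "dist_H (g n) q < e / (4 * C)"
    have "C * (dist_H (f n) p + dist_H (g n) q) < C * (e / (4 * C) + e / (4 * C))"
      using d C(1) by (intro mult_strict_left_mono add_strict_mono)
    also have "\<dots> = e / 2" using C(1) by simp
    finally have "C * (dist_H (f n) p + dist_H (g n) q) < e / 2" .
    moreover have "dist_H (f n) (f ?K) < e / 4" "dist_H (g n) (g ?K) < e / 4"
      using n by (intro M N; simp)+
    moreover have "dist_H (f n \<cdot> g n) (p \<cdot> q) \<le>
        dist_H (f n) (f ?K) + dist_H (g n) (g ?K) + C * (dist_H (f n) p + dist_H (g n) q)"
      by (intro C(2) Cauchy_F_mem f g pq)
    ultimately show "dist_H (f n \<cdot> g n) (p \<cdot> q) < e" by linarith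
  qed
qed

lemma mult_in_Cauchy_F:
  assumes f: "f \<in> Cauchy_F" and g: "g \<in> Cauchy_F"
  shows "(\<lambda>n. f n \<cdot> g n) \<in> Cauchy_F"
  unfolding Cauchy_F_def
proof (intro CollectI conjI allI impI)
  fix n show "f n \<cdot> g n \<in> carrier Thompson_F"
    using Cauchy_F_mem f g by (intro mult_F_closed)
next
  fix e :: real assume "e > 0"
  obtain N d where d: "d > 0"
      "\<forall>n\<ge>N. \<forall>p\<in>carrier Thompson_F. \<forall>q\<in>carrier Thompson_F.
        dist_H (f n) p < d \<longrightarrow> dist_H (g n) q < d \<longrightarrow> dist_H (f n \<cdot> g n) (p \<cdot> q) < e"
      using Cauchy_F_mult_uniform[OF f g \<open>e > 0\<close>] by blast
  obtain K where K: "\<And>m n. m \<ge> K \<Longrightarrow> n \<ge> K \<Longrightarrow> dist_H (f m) (f n) < d"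
    using Cauchy_FD[OF f d(1)] by blast
  obtain L where L: "\<And>m n. m \<ge> L \<Longrightarrow> n \<ge> L \<Longrightarrow> dist_H (g m) (g n) < d"
    using Cauchy_FD[OF g d(1)] by blast
  have "dist_H (f m \<cdot> g m) (f n \<cdot> g n) < e" if "m \<ge> max N (max K L)" "n \<ge> max N (max K L)" for m n
  proof (rule d(2)[rule_format])
    show "dist_H (f m) (f n) < d" "dist_H (g m) (g n) < d"
      using that by (intro K L; simp)+
  qed (use that in \<open>simp_all add: Cauchy_F_mem f g\<close>)
  then show "\<exists>N. \<forall>m\<ge>N. \<forall>n\<ge>N. dist_H (f m \<cdot> g m) (f n \<cdot> g n) < e" by blast
qed

lemma equiv_H_iff:
  "(f, g) \<in> equiv_H \<longleftrightarrow> f \<in> Cauchy_F \<and> g \<in> Cauchy_F \<and> (\<lambda>n. dist_H (f n) (g n)) \<longlonglongrightarrow> 0"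
  by (simp add: equiv_H_def)

lemma equiv_H_mult:
  assumes f: "(f, f') \<in> equiv_H" and g: "(g, g') \<in> equiv_H"
  shows "(\<lambda>n. f n \<cdot> g n, \<lambda>n. f' n \<cdot> g' n) \<in> equiv_H"
proof -
  have F: "f \<in> Cauchy_F" "f' \<in> Cauchy_F" "g \<in> Cauchy_F" "g' \<in> Cauchy_F"
    and lim: "(\<lambda>n. dist_H (f n) (f' n)) \<longlonglongrightarrow> 0" "(\<lambda>n. dist_H (g n) (g' n)) \<longlonglongrightarrow> 0"
    using f g by (simp_all add: equiv_H_iff)
  have "(\<lambda>n. dist_H (f n \<cdot> g n) (f' n \<cdot> g' n)) \<longlonglongrightarrow> 0"
  proof (rule order_tendstoI)
    fix e :: real assume "0 < e"
    obtain N d where d: "d > 0"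
      "\<forall>n\<ge>N. \<forall>p\<in>carrier Thompson_F. \<forall>q\<in>carrier Thompson_F.
        dist_H (f n) p < d \<longrightarrow> dist_H (g n) q < d \<longrightarrow> dist_H (f n \<cdot> g n) (p \<cdot> q) < e"
      using Cauchy_F_mult_uniform[OF F(1,3) \<open>e > 0\<close>] by blast
    have "\<forall>\<^sub>F n in sequentially. dist_H (f n) (f' n) < d"
      "\<forall>\<^sub>F n in sequentially. dist_H (g n) (g' n) < d"
      using lim d(1) by (auto dest: order_tendstoD(2))
    then show "\<forall>\<^sub>F n in sequentially. dist_H (f n \<cdot> g n) (f' n \<cdot> g' n) < e"
      using eventually_ge_at_top[of N]
      by eventually_elim (intro d(2)[rule_format] Cauchy_F_mem F)
  qed (intro always_eventually allI less_le_trans[OF _ dist_H_nonneg])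
  then show ?thesis using F by (simp add: equiv_H_iff mult_in_Cauchy_F)
qed

lemma equiv_equiv_H: "equiv Cauchy_F equiv_H"
proof (rule equivI)
  show "equiv_H \<subseteq> Cauchy_F \<times> Cauchy_F" by (auto simp: equiv_H_def)
  show "refl_on Cauchy_F equiv_H" by (auto simp: refl_on_def equiv_H_iff)
  show "sym equiv_H" by (auto simp: sym_def equiv_H_iff dist_H_commute)
  show "trans equiv_H"
  proof (rule transI)
    fix f g h assume "(f, g) \<in> equiv_H" "(g, h) \<in> equiv_H"
    then have F: "f \<in> Cauchy_F" "g \<in> Cauchy_F" "h \<in> Cauchy_F"
      and "(\<lambda>n. dist_H (f n) (g n)) \<longlonglongrightarrow> 0" "(\<lambda>n. dist_H (g n) (h n)) \<longlonglongrightarrow> 0"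
      by (simp_all add: equiv_H_iff)
    from tendsto_add_zero[OF this(4,5)]
    have "(\<lambda>n. dist_H (f n) (g n) + dist_H (g n) (h n)) \<longlonglongrightarrow> 0" .
    then have "(\<lambda>n. dist_H (f n) (h n)) \<longlonglongrightarrow> 0"
      by (rule tendsto_sandwich[OF _ _ tendsto_const, rotated 2])
        (auto intro!: always_eventually dist_H_triangle Cauchy_F_mem F)
    with F show "(f, h) \<in> equiv_H" by (simp add: equiv_H_iff)
  qed
qed

section \<open>The completion is a group\<close>

text \<open>
  The union over all representatives collapses because the termwise product is compatible with
  equivalence.
\<close>

lemma mult_F_bar_class:
  assumes "f \<in> Cauchy_F" "g \<in> Cauchy_F"
  shows "equiv_H `` {f} \<otimes>\<^bsub>F_bar\<^esub> equiv_H `` {g} = equiv_H `` {\<lambda>n. f n \<cdot> g n}"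
proof -
  have "congruent2 equiv_H equiv_H (\<lambda>f g. equiv_H `` {\<lambda>n. f n \<cdot> g n})"
    by (auto intro!: congruent2I' equiv_class_eq[OF equiv_equiv_H] equiv_H_mult)
  then show ?thesis
    using UN_equiv_class2[OF equiv_equiv_H equiv_equiv_H _ assms] by (simp add: F_bar_def)
qed

lemma carrier_F_bar: "carrier F_bar = Cauchy_F // equiv_H"
  by (simp add: F_bar_def)

lemma one_F_bar: "\<one>\<^bsub>F_bar\<^esub> = equiv_H `` {\<lambda>n. \<one>\<^bsub>Thompson_F\<^esub>}"
  by (simp add: F_bar_def const_class_def)

lemma carrier_F_barE:
  assumes "X \<in> carrier F_bar"
  obtains f where "f \<in> Cauchy_F" "X = equiv_H `` {f}"
  using assms by (auto simp: carrier_F_bar elim: quotientE)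

lemma class_in_F_bar: "f \<in> Cauchy_F \<Longrightarrow> equiv_H `` {f} \<in> carrier F_bar"
  by (simp add: carrier_F_bar quotientI)

lemma one_in_Cauchy_F: "(\<lambda>n. \<one>\<^bsub>Thompson_F\<^esub>) \<in> Cauchy_F"
  by (intro const_in_Cauchy_F monoid.one_closed[OF group.is_monoid[OF group_Thompson_F]])

lemma group_F_bar: "group F_bar"
proof (rule groupI)
  interpret F: group Thompson_F by (rule group_Thompson_F)
  show "X \<otimes>\<^bsub>F_bar\<^esub> Y \<in> carrier F_bar" if "X \<in> carrier F_bar" "Y \<in> carrier F_bar" for X Y
    using that by (auto elim!: carrier_F_barE simp: mult_F_bar_class class_in_F_bar mult_in_Cauchy_F)
  show "\<one>\<^bsub>F_bar\<^esub> \<in> carrier F_bar"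
    using one_in_Cauchy_F by (simp add: one_F_bar class_in_F_bar)
  show "X \<otimes>\<^bsub>F_bar\<^esub> Y \<otimes>\<^bsub>F_bar\<^esub> Z = X \<otimes>\<^bsub>F_bar\<^esub> (Y \<otimes>\<^bsub>F_bar\<^esub> Z)"
    if "X \<in> carrier F_bar" "Y \<in> carrier F_bar" "Z \<in> carrier F_bar" for X Y Z
    using that
    by (auto elim!: carrier_F_barE simp: mult_F_bar_class mult_in_Cauchy_F F.m_assoc Cauchy_F_mem)
  show "\<one>\<^bsub>F_bar\<^esub> \<otimes>\<^bsub>F_bar\<^esub> X = X" if "X \<in> carrier F_bar" for X
    using that one_in_Cauchy_F
    by (auto elim!: carrier_F_barE simp: one_F_bar mult_F_bar_class Cauchy_F_mem)
  show "\<exists>Y\<in>carrier F_bar. Y \<otimes>\<^bsub>F_bar\<^esub> X = \<one>\<^bsub>F_bar\<^esub>" if "X \<in> carrier F_bar" for X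
  proof -
    obtain f where f: "f \<in> Cauchy_F" "X = equiv_H `` {f}"
      using carrier_F_barE[OF \<open>X \<in> carrier F_bar\<close>] .
    have "equiv_H `` {\<lambda>n. inv_F (f n)} \<otimes>\<^bsub>F_bar\<^esub> X = \<one>\<^bsub>F_bar\<^esub>"
      using f by (simp add: mult_F_bar_class inv_in_Cauchy_F one_F_bar Cauchy_F_mem)
    then show ?thesis
      using class_in_F_bar[OF inv_in_Cauchy_F[OF f(1)]] by blast
  qed
qed

section \<open>The limit homeomorphism of a Cauchy sequence\<close>

definition lim_F :: "(nat \<Rightarrow> real \<Rightarrow> real) \<Rightarrow> real \<Rightarrow> real" where
  "lim_F f = (\<lambda>x\<in>{0..1}. lim (\<lambda>n. f n x))"

text \<open>
  The Hamming metric dominates the uniform metric; hence Cauchy sequences converge uniformly.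
\<close>

lemma abs_diff_le_dist_H:
  assumes "f \<in> carrier Thompson_F" "g \<in> carrier Thompson_F" "x \<in> {0..1}"
  shows "\<bar>f x - g x\<bar> \<le> dist_H f g"
proof -
  have "\<bar>f x - g x\<bar> \<le> disagree (inv_into {0..1} f) (inv_into {0..1} g)"
    using assms by (intro abs_diff_le_disagree_inv Thompson_F_Homeo01 Thompson_F_mono)
  also have "\<dots> \<le> dist_H f g"
    by (simp add: dist_H_def disagree_def)
  finally show ?thesis .
qed

lemma Cauchy_F_LIMSEQ:
  assumes "f \<in> Cauchy_F" "x \<in> {0..1}"
  shows "(\<lambda>n. f n x) \<longlonglongrightarrow> lim_F f x"
proof -
  have "Cauchy (\<lambda>n. f n x)"
  proof (rule metric_CauchyI)
    fix e :: real assume "e > 0"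
    obtain N where N: "\<And>m n. m \<ge> N \<Longrightarrow> n \<ge> N \<Longrightarrow> dist_H (f m) (f n) < e"
      using Cauchy_FD[OF assms(1) \<open>e > 0\<close>] by blast
    have "dist (f m x) (f n x) < e" if "m \<ge> N" "n \<ge> N" for m n
      using abs_diff_le_dist_H[OF Cauchy_F_mem[OF assms(1), of m] Cauchy_F_mem[OF assms(1), of n] assms(2)]
        N[OF that] by (simp only: dist_real_def)
    then show "\<exists>M. \<forall>m\<ge>M. \<forall>n\<ge>M. dist (f m x) (f n x) < e" by blast
  qed
  then show ?thesis
    using assms(2) by (simp add: lim_F_def Cauchy_convergent convergent_LIMSEQ_iff[symmetric])
qed

lemma Cauchy_F_uniform_limit:
  assumes "f \<in> Cauchy_F"
  shows "uniform_limit {0..1} f (lim_F f) sequentially"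
proof (rule uniform_limitI)
  fix e :: real assume "e > 0"
  then have "e / 2 > 0" by simp
  obtain N where N: "\<And>m n. m \<ge> N \<Longrightarrow> n \<ge> N \<Longrightarrow> dist_H (f m) (f n) < e / 2"
    using Cauchy_FD[OF assms \<open>e / 2 > 0\<close>] by blast
  have "dist (f n x) (lim_F f x) < e" if "n \<ge> N" "x \<in> {0..1}" for n x
  proof -
    have "\<bar>f m x - f n x\<bar> \<le> e / 2" if "m \<ge> N" for m
      using abs_diff_le_dist_H[OF Cauchy_F_mem[OF assms, of m] Cauchy_F_mem[OF assms, of n] \<open>x \<in> {0..1}\<close>]
        N[OF that \<open>n \<ge> N\<close>] by linarith
    moreover have "(\<lambda>m. \<bar>f m x - f n x\<bar>) \<longlonglongrightarrow> \<bar>lim_F f x - f n x\<bar>"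
      by (intro tendsto_intros Cauchy_F_LIMSEQ assms that)
    ultimately have "\<bar>lim_F f x - f n x\<bar> \<le> e / 2"
      by (intro LIMSEQ_le_const2) auto
    with \<open>e > 0\<close> show ?thesis by (simp add: dist_real_def abs_minus_commute)
  qed
  then show "\<forall>\<^sub>F n in sequentially. \<forall>x\<in>{0..1}. dist (f n x) (lim_F f x) < e"
    unfolding eventually_sequentially by blast
qed

lemma lim_F_mem:
  assumes "f \<in> Cauchy_F" "x \<in> {0..1}"
  shows "lim_F f x \<in> {0..1}"
proof (rule closed_sequentially[OF closed_atLeastAtMost])
  show "f n x \<in> {0..1}" for n
    using Homeo01_mem(1)[OF Thompson_F_Homeo01[OF Cauchy_F_mem[OF assms(1)]] assms(2)] .
  show "(\<lambda>n. f n x) \<longlonglongrightarrow> lim_F f x"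
    using assms by (rule Cauchy_F_LIMSEQ)
qed

lemma lim_F_continuous:
  assumes "f \<in> Cauchy_F"
  shows "continuous_on {0..1} (lim_F f)"
  using assms
  by (intro uniform_limit_theorem[OF _ Cauchy_F_uniform_limit])
    (auto intro!: always_eventually Thompson_F_continuous Cauchy_F_mem)

lemma lim_F_const: "f \<in> carrier Thompson_F \<Longrightarrow> lim_F (\<lambda>n. f) = f"
  using Thompson_F_Homeo01[of f]
  by (auto simp: lim_F_def carrier_Homeo01 Bij_def intro!: extensionalityI[of _ "{0..1}"])

text \<open>
  Here uniform convergence is essential: \<open>f n\<close> is evaluated at the moving point \<open>g n x\<close>.
\<close>

lemma lim_F_mult:
  assumes f: "f \<in> Cauchy_F" and g: "g \<in> Cauchy_F"
  shows "lim_F (\<lambda>n. f n \<cdot> g n) = compose {0..1} (lim_F f) (lim_F g)"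
proof (rule extensionalityI[of _ "{0..1}"])
  fix x :: real assume x: "x \<in> {0..1}"
  have mem: "g n x \<in> {0..1}" for n
    using Homeo01_mem(1)[OF Thompson_F_Homeo01[OF Cauchy_F_mem[OF g]] x] .
  have "(\<lambda>n. lim_F f (g n x)) \<longlonglongrightarrow> lim_F f (lim_F g x)"
    by (rule continuous_on_tendsto_compose[OF lim_F_continuous[OF f] Cauchy_F_LIMSEQ[OF g x]])
      (use mem lim_F_mem[OF g x] in auto)
  moreover have "(\<lambda>n. f n (g n x) - lim_F f (g n x)) \<longlonglongrightarrow> 0"
  proof (rule LIMSEQ_I)
    fix e :: real assume "e > 0"
    then have "\<forall>\<^sub>F n in sequentially. \<forall>y\<in>{0..1}. dist (f n y) (lim_F f y) < e"
      by (rule uniform_limitD[OF Cauchy_F_uniform_limit[OF f]])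
    then obtain N where "\<forall>n\<ge>N. \<forall>y\<in>{0..1}. dist (f n y) (lim_F f y) < e"
      by (auto simp only: eventually_sequentially)
    then have "\<forall>n\<ge>N. norm (f n (g n x) - lim_F f (g n x) - 0) < e"
      using mem by (simp only: dist_norm diff_0_right) blast
    then show "\<exists>N. \<forall>n\<ge>N. norm (f n (g n x) - lim_F f (g n x) - 0) < e" ..
  qed
  ultimately have "(\<lambda>n. f n (g n x)) \<longlonglongrightarrow> lim_F f (lim_F g x)"
    by (rule Lim_transform[rotated, rotated]) 
  moreover have "(f n \<cdot> g n) x = f n (g n x)" for n
    using x by (intro mult_F_apply Cauchy_F_mem f g)
  ultimately have "(\<lambda>n. (f n \<cdot> g n) x) \<longlonglongrightarrow> lim_F f (lim_F g x)"
    by simp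
  with Cauchy_F_LIMSEQ[OF mult_in_Cauchy_F[OF f g] x]
  have "lim_F (\<lambda>n. f n \<cdot> g n) x = lim_F f (lim_F g x)"
    by (rule LIMSEQ_unique)
  with x show "lim_F (\<lambda>n. f n \<cdot> g n) x = compose {0..1} (lim_F f) (lim_F g) x"
    by (simp only: compose_eq)
qed (simp_all add: lim_F_def compose_def)

text \<open>
  The inverses form a Cauchy sequence too, and multiplicativity of the limit shows that their limit
  is a two-sided inverse. So the limit, a priori only a weakly increasing map, is bijective.
\<close>

lemma lim_F_inv:
  assumes f: "f \<in> Cauchy_F" and x: "x \<in> {0..1}"
  shows "lim_F f (lim_F (\<lambda>n. inv_F (f n)) x) = x" "lim_F (\<lambda>n. inv_F (f n)) (lim_F f x) = x"
proof -
  interpret F: group Thompson_F by (rule group_Thompson_F)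
  have "compose {0..1} (lim_F f) (lim_F (\<lambda>n. inv_F (f n))) = (\<lambda>x\<in>{0..1}. x)"
    "compose {0..1} (lim_F (\<lambda>n. inv_F (f n))) (lim_F f) = (\<lambda>x\<in>{0..1}. x)"
    using lim_F_mult[OF f inv_in_Cauchy_F[OF f]] lim_F_mult[OF inv_in_Cauchy_F[OF f] f]
      lim_F_const[OF F.one_closed] by (simp_all add: Cauchy_F_mem f one_Thompson_F)
  from this[THEN fun_cong[of _ _ x]] x
  show "lim_F f (lim_F (\<lambda>n. inv_F (f n)) x) = x" "lim_F (\<lambda>n. inv_F (f n)) (lim_F f x) = x"
    by (simp_all add: compose_eq)
qed

lemma lim_F_Homeo01:
  assumes f: "f \<in> Cauchy_F"
  shows "lim_F f \<in> carrier Homeo01"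
proof -
  have "bij_betw (lim_F f) {0..1} {0..1}"
    by (rule bij_betw_byWitness[where f' = "lim_F (\<lambda>n. inv_F (f n))"])
      (use lim_F_mem[OF f] lim_F_mem[OF inv_in_Cauchy_F[OF f]] lim_F_inv[OF f] in blast)+
  moreover have "lim_F f \<in> extensional {0..1}"
    by (simp add: lim_F_def)
  ultimately show ?thesis
    using lim_F_continuous[OF f] by (simp add: carrier_Homeo01 Bij_def)
qed

lemma lim_F_cong:
  assumes "(f, g) \<in> equiv_H"
  shows "lim_F f = lim_F g"
proof (rule extensionalityI[of _ "{0..1}"])
  fix x :: real assume x: "x \<in> {0..1}"
  have F: "f \<in> Cauchy_F" "g \<in> Cauchy_F" and "(\<lambda>n. dist_H (f n) (g n)) \<longlonglongrightarrow> 0"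
    using assms by (simp_all add: equiv_H_iff)
  have "(\<lambda>n. f n x - g n x) \<longlonglongrightarrow> 0"
  proof (rule Lim_null_comparison[OF always_eventually \<open>(\<lambda>n. dist_H (f n) (g n)) \<longlonglongrightarrow> 0\<close>], rule allI)
    fix n show "norm (f n x - g n x) \<le> dist_H (f n) (g n)"
      unfolding real_norm_def by (intro abs_diff_le_dist_H Cauchy_F_mem F x)
  qed
  with tendsto_diff[OF Cauchy_F_LIMSEQ[OF F(1) x] Cauchy_F_LIMSEQ[OF F(2) x]]
  have "lim_F f x - lim_F g x = 0" by (rule LIMSEQ_unique)
  then show "lim_F f x = lim_F g x" by simp
qed (simp_all add: lim_F_def)

section \<open>The limit determines the class of the sequence\<close>

text \<open>
  A Fatou argument. If \<open>g x \<noteq> h x\<close>, then \<open>f m x\<close> is eventually close to \<open>h x\<close> and thus different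
  from \<open>g x\<close>. So the disagreement set of \<open>g\<close> and \<open>h\<close> lies in the increasing union of the sets
  \<open>B k\<close> where \<open>g\<close> disagrees with every \<open>f m\<close>, \<open>m \<ge> k\<close>, each of measure at most \<open>e\<close>.
\<close>

lemma disagree_lim_le:
  assumes cont: "\<And>n. continuous_on {0..1} (f n)" "continuous_on {0..1} h"
    and lim: "\<And>x. x \<in> {0..1} \<Longrightarrow> (\<lambda>n. f n x) \<longlonglongrightarrow> h x"
    and "continuous_on {0..1} g" and le: "\<And>m. m \<ge> N \<Longrightarrow> disagree g (f m) \<le> e"
  shows "disagree g h \<le> e"
proof -
  define A where "A m = {x \<in> {0..1}. g x \<noteq> f m x}" for m
  define B where "B k = (\<Inter>m\<in>{k..}. A m)" for k
  have A: "A m \<in> lmeasurable" for m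
    unfolding A_def using assms by (intro lmeasurable_disagree)
  have B: "B k \<in> sets lebesgue" for k
    unfolding B_def using A by (intro sets.countable_INT') (auto dest: fmeasurableD)
  have "incseq B"
    unfolding B_def by (intro monoI INF_superset_mono) auto
  have sub: "(\<Union>k. B k) \<subseteq> {0..1}"
    by (auto simp: B_def A_def)
  have UB: "(\<Union>k. B k) \<in> lmeasurable"
    by (rule fmeasurableI2[OF _ sub]) (use B in auto)
  then have "(\<lambda>k. measure lebesgue (B k)) \<longlonglongrightarrow> measure lebesgue (\<Union>k. B k)"
    using B \<open>incseq B\<close> by (intro Lim_measure_incseq) (auto simp: fmeasurable_def less_top)
  moreover have "measure lebesgue (B k) \<le> e" for k
  proof -
    have "measure lebesgue (B k) \<le> measure lebesgue (A (max k N))"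
      by (intro measure_mono_fmeasurable A B) (auto simp: B_def)
    also have "\<dots> \<le> e" using le[of "max k N"] by (simp add: A_def disagree_def)
    finally show ?thesis .
  qed
  ultimately have "measure lebesgue (\<Union>k. B k) \<le> e"
    by (intro LIMSEQ_le_const2) auto
  moreover have "{x \<in> {0..1}. g x \<noteq> h x} \<subseteq> (\<Union>k. B k)"
  proof
    fix x assume x: "x \<in> {x \<in> {0..1}. g x \<noteq> h x}"
    then have "\<forall>\<^sub>F n in sequentially. f n x \<noteq> g x"
      using lim[of x] tendsto_imp_eventually_ne[of "\<lambda>n. f n x" "h x" sequentially "g x"] by auto
    then obtain k where "\<forall>n\<ge>k. f n x \<noteq> g x"
      by (auto simp: eventually_sequentially)
    with x have "x \<in> B k" by (auto simp: B_def A_def)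
    then show "x \<in> (\<Union>k. B k)" by blast
  qed
  then have "disagree g h \<le> measure lebesgue (\<Union>k. B k)"
    unfolding disagree_def using assms(2,4)
    by (intro measure_mono_fmeasurable UB fmeasurableD lmeasurable_disagree)
  ultimately show ?thesis by linarith
qed

text \<open>
  A Cauchy sequence agrees with its limit off sets of measure tending to zero, although the limit
  need not lie in Thompson's group.
\<close>

lemma disagree_lim_F_tendsto:
  assumes f: "f \<in> Cauchy_F"
  shows "(\<lambda>n. disagree (f n) (lim_F f)) \<longlonglongrightarrow> 0"
proof (rule LIMSEQ_I)
  fix e :: real assume "e > 0"
  then have "e / 2 > 0" by simp
  obtain N where N: "\<And>m n. m \<ge> N \<Longrightarrow> n \<ge> N \<Longrightarrow> dist_H (f m) (f n) < e / 2"
    using Cauchy_FD[OF f \<open>e / 2 > 0\<close>] by blast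
  have "disagree (f n) (lim_F f) \<le> e / 2" if "n \<ge> N" for n
  proof (rule disagree_lim_le)
    fix m assume "m \<ge> N"
    have "disagree (f n) (f m) \<le> dist_H (f n) (f m)"
      by (simp add: dist_H_eq Cauchy_F_mem f)
    with N[OF \<open>n \<ge> N\<close> \<open>m \<ge> N\<close>] show "disagree (f n) (f m) \<le> e / 2" by linarith
  qed (intro Cauchy_F_LIMSEQ lim_F_continuous Thompson_F_continuous Cauchy_F_mem f; assumption)+
  with \<open>e > 0\<close> have "norm (disagree (f n) (lim_F f) - 0) < e" if "n \<ge> N" for n
    using that by force
  then show "\<exists>N. \<forall>n\<ge>N. norm (disagree (f n) (lim_F f) - 0) < e" by blast
qed

lemma lim_F_eq_imp_disagree_tendsto:
  assumes f: "f \<in> Cauchy_F" and g: "g \<in> Cauchy_F" and eq: "lim_F f = lim_F g"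
  shows "(\<lambda>n. disagree (f n) (g n)) \<longlonglongrightarrow> 0"
proof (rule tendsto_sandwich[OF _ _ tendsto_const])
  show "(\<lambda>n. disagree (f n) (lim_F f) + disagree (g n) (lim_F g)) \<longlonglongrightarrow> 0"
    by (intro tendsto_add_zero disagree_lim_F_tendsto f g)
  have "disagree (f n) (g n) \<le> disagree (f n) (lim_F f) + disagree (g n) (lim_F g)" for n
    using disagree_triangle[OF Thompson_F_continuous[OF Cauchy_F_mem[OF f]]
        lim_F_continuous[OF f] Thompson_F_continuous[OF Cauchy_F_mem[OF g]], of n n]
      disagree_commute[of "g n" "lim_F g"] eq by simp
  then show "\<forall>\<^sub>F n in sequentially. disagree (f n) (g n) \<le>
      disagree (f n) (lim_F f) + disagree (g n) (lim_F g)"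
    by (rule always_eventually[OF allI])
qed simp

text \<open>
  Injectivity. Equal limits have equal inverses, so the sequences of maps and the sequences of
  inverses each agree with a common limit up to small measure.
\<close>

lemma lim_F_eq_imp_equiv_H:
  assumes f: "f \<in> Cauchy_F" and g: "g \<in> Cauchy_F" and eq: "lim_F f = lim_F g"
  shows "(f, g) \<in> equiv_H"
proof -
  let ?f' = "\<lambda>n. inv_F (f n)" and ?g' = "\<lambda>n. inv_F (g n)"
  have "lim_F ?f' = lim_F ?g'"
  proof (rule extensionalityI[of _ "{0..1}"])
    fix x :: real assume x: "x \<in> {0..1}"
    have "lim_F ?f' x = lim_F ?f' (lim_F g (lim_F ?g' x))"
      by (simp only: lim_F_inv(1)[OF g x])
    also have "\<dots> = lim_F ?g' x"
      unfolding eq[symmetric] by (rule lim_F_inv(2)[OF f lim_F_mem[OF inv_in_Cauchy_F[OF g] x]])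
    finally show "lim_F ?f' x = lim_F ?g' x" .
  qed (simp_all add: lim_F_def)
  then have "(\<lambda>n. disagree (inv_F (f n)) (inv_F (g n))) \<longlonglongrightarrow> 0"
    by (rule lim_F_eq_imp_disagree_tendsto[OF inv_in_Cauchy_F[OF f] inv_in_Cauchy_F[OF g]])
  from tendsto_add_zero[OF lim_F_eq_imp_disagree_tendsto[OF f g eq] this]
  show ?thesis by (simp add: equiv_H_iff f g dist_H_eq Cauchy_F_mem)
qed

text \<open>
  The embedding. The choice of a representative is harmless since equivalent sequences have the
  same limit.
\<close>

definition limit_map :: "(nat \<Rightarrow> real \<Rightarrow> real) set \<Rightarrow> real \<Rightarrow> real" where
  "limit_map X = lim_F (SOME f. f \<in> X)"

lemma limit_map_class:
  assumes "f \<in> Cauchy_F"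
  shows "limit_map (equiv_H `` {f}) = lim_F f"
proof -
  have "f \<in> equiv_H `` {f}"
    using equiv_class_self[OF equiv_equiv_H assms] .
  then have "(SOME g. g \<in> equiv_H `` {f}) \<in> equiv_H `` {f}"
    by (rule someI[where P = "\<lambda>g. g \<in> equiv_H `` {f}"])
  then have "(f, SOME g. g \<in> equiv_H `` {f}) \<in> equiv_H"
    by (simp only: Image_singleton_iff)
  then show ?thesis
    unfolding limit_map_def by (rule lim_F_cong[symmetric])
qed

theorem theorem7p3:
  "\<exists>\<phi>. group_hom F_bar Homeo01 \<phi> \<and> inj_on \<phi> (carrier F_bar) \<and>
       (\<forall>f \<in> carrier Thompson_F. \<phi> (const_class f) = f)"
proof (intro exI[of _ limit_map] conjI ballI)
  have "limit_map \<in> hom F_bar Homeo01"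
  proof (rule homI)
    fix X assume "X \<in> carrier F_bar"
    then show "limit_map X \<in> carrier Homeo01"
      by (elim carrier_F_barE) (simp add: limit_map_class lim_F_Homeo01)
  next
    fix X Y assume "X \<in> carrier F_bar" "Y \<in> carrier F_bar"
    then show "limit_map (X \<otimes>\<^bsub>F_bar\<^esub> Y) = limit_map X \<otimes>\<^bsub>Homeo01\<^esub> limit_map Y"
      by (elim carrier_F_barE)
        (simp add: mult_F_bar_class limit_map_class mult_in_Cauchy_F lim_F_mult mult_Homeo01 lim_F_Homeo01)
  qed
  then show "group_hom F_bar Homeo01 limit_map"
    by (intro group_hom.intro group_hom_axioms.intro group_F_bar group_Homeo01)
  show "inj_on limit_map (carrier F_bar)"
  proof (rule inj_onI)
    fix X Y assume "X \<in> carrier F_bar" "Y \<in> carrier F_bar" "limit_map X = limit_map Y"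
    then show "X = Y"
      by (elim carrier_F_barE)
        (simp add: limit_map_class equiv_class_eq[OF equiv_equiv_H] lim_F_eq_imp_equiv_H)
  qed
  fix f assume "f \<in> carrier Thompson_F"
  then show "limit_map (const_class f) = f"
    by (simp add: const_class_def limit_map_class const_in_Cauchy_F lim_F_const)
qed

end
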